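(* If $n\ge5$ is square-free and $n\equiv1\pmod 4$, then there are polynomials $E_n(s,t),F_n(s,t)\in\mathbb{Z}[s,t]$ such that $$4P_n(s,t)=E_n^2(s,t)-n\,t^2F_n^2(s,t),$$ with $\mathrm{sdeg}\,E_n=\phi(n)/2$ and $\mathrm{sdeg}\,F_n=\phi(n)/2-2$.
   Context: Let $\Phi_n(q)$ be the $n$th cyclotomic polynomial and $\phi$ the Euler totient function. For $n\ge 2$, $\Phi_n(q)$ is palindromic of degree $\phi(n)$ with constant term $1$, so there are unique complex numbers $\gamma_j$ with $\Phi_n(q)=\sum_{0\le j\le \phi(n)/2}\gamma_j q^j(1+q)^{\phi(n)-2j}$; the $n$th Lucas atom is $P_n(s,t)=\sum_j \gamma_j s^{\phi(n)-2j}(-t)^j$. For $f\in\mathbb{C}[s,t]$, $\mathrm{sdeg}\,f$ denotes the largest power of $s$ occurring in $f$. *)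

theory Defs
  imports
    Complex_Main
    "HOL-Computational_Algebra.Computational_Algebra"
    "HOL-Number_Theory.Totient"
begin

definition primitive_roots_of_unity :: "nat \<Rightarrow> complex set" where
  "primitive_roots_of_unity n = {z. z ^ n = 1 \<and> (\<forall>m. 0 < m \<and> m < n \<longrightarrow> z ^ m \<noteq> 1)}"

definition cyclotomic :: "nat \<Rightarrow> complex poly" where
  "cyclotomic n = (\<Prod>z\<in>primitive_roots_of_unity n. [:- z, 1:])"

text \<open>
  The coefficients gamma_j, extended by 0 to all indices j > totient n / 2, which makes the
  sequence unique as a function on the natural numbers. Here q is the polynomial [:0, 1:]
  and 1 + q is [:1, 1:]. Intended for n at least 2.
\<close>

definition lucas_gamma :: "nat \<Rightarrow> nat \<Rightarrow> complex" where
  "lucas_gamma n = (THE g. (\<forall>j. j > totient n div 2 \<longrightarrow> g j = 0) \<and>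
     cyclotomic n =
       (\<Sum>j\<le>totient n div 2. smult (g j) ([:0, 1:] ^ j * [:1, 1:] ^ (totient n - 2 * j))))"

text \<open>
  R[s,t] is represented as R[t][s]: the outer variable is s and the coefficients are
  polynomials in t.
\<close>

type_synonym 'a bipoly = "'a poly poly"

definition svar :: "'a::comm_semiring_1 bipoly" where
  "svar = [:0, 1:]"

definition tvar :: "'a::comm_semiring_1 bipoly" where
  "tvar = [:[:0, 1:]:]"

abbreviation bconst :: "'a::comm_semiring_1 \<Rightarrow> 'a bipoly" where
  "bconst c \<equiv> [:[:c:]:]"

text \<open>
  As for \<^const>\<open>degree\<close>, the value at the zero polynomial is 0.
\<close>

abbreviation sdeg :: "'a::zero bipoly \<Rightarrow> nat" where
  "sdeg f \<equiv> degree f"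

definition lucas_atom :: "nat \<Rightarrow> complex bipoly" where
  "lucas_atom n =
     (\<Sum>j\<le>totient n div 2. bconst (lucas_gamma n j) * svar ^ (totient n - 2 * j) * (- tvar) ^ j)"

definition of_int_bipoly :: "int bipoly \<Rightarrow> complex bipoly" where
  "of_int_bipoly = map_poly (map_poly of_int)"

end

(*
  Gauss's factorisation of the cyclotomic polynomial.  With chi the Jacobi symbol modulo n and zeta
  a primitive n-th root of unity, Phi_n = f_1 * f_{-1}, where f_s is the product of 1 - zeta^a X over
  the residues a with chi(a) = s.  The power sums of the roots of f_1 and f_{-1} are conjugate in
  Q(G), where G is the Gauss sum, G^2 = n, so Newton's identities make their coefficients conjugate
  as well; these are moreover cyclotomic integers.  Hence A = f_1 + f_{-1} and C = (f_1 - f_{-1}) / G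
  have integer coefficients and 4 Phi_n = A^2 - n C^2.  Since chi is even, f_1 and f_{-1} are
  palindromic; C is divisible by X because both constant terms are 1, and its linear coefficient
  is -1 because the linear coefficients of f_1 and f_{-1} differ by -G.
  A palindromic polynomial of degree 2 m is a binary form of degree m in (1 + q)^2 and q; replacing
  these by s^2 and -t turns Phi_n into the Lucas atom and Gauss's identity into the required one.
*)
theory Submission
  imports Defs "HOL-Number_Theory.Number_Theory"
begin

hide_const (open) up_ring.coeff up_ring.monom module.smult

section \<open>The Jacobi symbol\<close>

text \<open>Each prime divisor counts once. For odd squarefree \<open>n\<close>, the case of
  interest, this is the classical Jacobi symbol.\<close>

definition jacobi :: "nat \<Rightarrow> int \<Rightarrow> int" where
  "jacobi n a = (\<Prod>p\<in>prime_factors n. Legendre a (int p))"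

section \<open>Legendre symbols at odd primes\<close>

lemma Legendre_values: "Legendre a p \<in> {-1, 0, 1}"
  by (simp add: Legendre_def)

lemma Legendre_cong:
  assumes "[a = b] (mod p)"
  shows "Legendre a p = Legendre b p"
proof -
  have "[a = 0] (mod p) \<longleftrightarrow> [b = 0] (mod p)" "QuadRes p a \<longleftrightarrow> QuadRes p b"
    using assms unfolding QuadRes_def by (meson cong_sym cong_trans)+
  then show ?thesis by (simp add: Legendre_def)
qed

text \<open>Two such values differ by at most 2, less than the modulus. This turns congruences, such
  as Euler's criterion, into equalities.\<close>

lemma cong_unit_imp_eq:
  fixes x y m :: int
  assumes "[x = y] (mod m)" and "m > 2" and "x \<in> {-1, 0, 1}" and "y \<in> {-1, 0, 1}"
  shows "x = y"
proof -
  have "m dvd x - y" using assms(1) by (simp add: cong_iff_dvd_diff)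
  then show ?thesis
    using assms(2-4) zdvd_imp_le[of m "x - y"] zdvd_imp_le[of m "y - x"]
    by (auto simp: dvd_diff_commute)
qed

text \<open>By Euler's criterion both sides are congruent to the same power of
  \<open>a * b\<close>.\<close>

lemma Legendre_mult:
  assumes "prime p" and "p > (2::nat)"
  shows "Legendre (a * b) p = Legendre a p * Legendre b p"
proof (rule cong_unit_imp_eq)
  let ?k = "(p - 1) div 2"
  have "[Legendre (a * b) p = (a * b) ^ ?k] (mod p)"
    by (rule euler_criterion) (use assms in auto)
  moreover have "[Legendre a p * Legendre b p = a ^ ?k * b ^ ?k] (mod p)"
    by (intro cong_mult euler_criterion) (use assms in auto)
  ultimately show "[Legendre (a * b) p = Legendre a p * Legendre b p] (mod p)"
    by (metis cong_sym cong_trans power_mult_distrib)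
  show "int p > 2" using assms by simp
  show "Legendre (a * b) p \<in> {-1, 0, 1}" by (rule Legendre_values)
  show "Legendre a p * Legendre b p \<in> {-1, 0, 1}"
    using Legendre_values[of a p] Legendre_values[of b p] by auto
qed

text \<open>Euler's criterion gives a power of -1 whose sign depends on \<open>p\<close> modulo 4.
  In this form the result can be multiplied over the prime divisors of \<open>n\<close>.\<close>

lemma Legendre_minus_one_cong:
  assumes "prime p" and "p > (2::nat)"
  shows "[Legendre (-1) p = int p] (mod 4)"
proof -
  have "odd p" using assms prime_odd_nat by blast
  have "Legendre (-1) p = (-1) ^ ((p - 1) div 2)"
  proof (rule cong_unit_imp_eq)
    show "[Legendre (-1) p = (-1) ^ ((p - 1) div 2)] (mod p)"
      using assms by (rule euler_criterion)
    show "(- 1 :: int) ^ ((p - 1) div 2) \<in> {- 1, 0, 1}"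
      by (cases "even ((p - 1) div 2)") auto
  qed (use assms Legendre_values in auto)
  moreover obtain k where k: "p = 2 * k + 1" using \<open>odd p\<close> by (elim oddE)
  ultimately show ?thesis
    by (cases "even k") (auto simp: cong_iff_dvd_diff elim!: evenE oddE)
qed

text \<open>Were every residue a square, squaring would be onto the finite set of residues and hence
  injective, yet 1 and \<open>p - 1\<close> have the same square.\<close>

lemma exists_Legendre_eq_minus_one:
  assumes "prime p" and "p > (2::nat)"
  shows "\<exists>a. Legendre a p = -1"
proof (rule ccontr)
  assume *: "\<nexists>a. Legendre a p = -1"
  let ?R = "{0..<int p}" and ?sq = "\<lambda>y. y\<^sup>2 mod int p"
  have p0: "int p > 0" using assms by simp
  have "?R \<subseteq> ?sq ` ?R"
  proof
    fix a assume a: "a \<in> ?R"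
    have "\<exists>y. [y\<^sup>2 = a] (mod p)"
    proof (cases "[a = 0] (mod p)")
      case True
      then have "[0\<^sup>2 = a] (mod p)" by (simp add: cong_sym_eq)
      then show ?thesis by blast
    next
      case False
      then show ?thesis using * unfolding Legendre_def QuadRes_def by metis
    qed
    then obtain y where "[y\<^sup>2 = a] (mod p)" by blast
    then have "a = ?sq (y mod int p)"
      using a by (simp add: cong_def power_mod)
    moreover have "y mod int p \<in> ?R" using p0 by simp
    ultimately show "a \<in> ?sq ` ?R" by blast
  qed
  moreover have "?sq ` ?R \<subseteq> ?R" using p0 by auto
  ultimately have "inj_on ?sq ?R"
    by (intro eq_card_imp_inj_on) (auto dest: subset_antisym)
  moreover have "?sq 1 = ?sq (int p - 1)"
  proof -
    have "1 - (int p - 1)\<^sup>2 = int p * (2 - int p)" by (simp add: power2_eq_square algebra_simps)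
    then have "[1\<^sup>2 = (int p - 1)\<^sup>2] (mod p)" by (simp add: cong_iff_dvd_diff)
    then show ?thesis by (simp add: cong_def)
  qed
  ultimately have "1 = int p - 1" using assms by (elim inj_onD) auto
  then show False using assms by simp
qed

section \<open>The Jacobi symbol as a character modulo n\<close>

lemma jacobi_values: "jacobi n a \<in> {-1, 0, 1}"
proof -
  have "(\<Prod>p\<in>A. Legendre a (int p)) \<in> {-1, 0, 1}" for A :: "nat set"
  proof (induction A rule: infinite_finite_induct)
    case (insert p A)
    then show ?case using Legendre_values[of a "int p"] by auto
  qed auto
  then show ?thesis unfolding jacobi_def .
qed

lemma jacobi_cong:
  assumes "[a = b] (mod int n)"
  shows "jacobi n a = jacobi n b"
  unfolding jacobi_def
proof (rule prod.cong)
  fix p assume "p \<in> prime_factors n"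
  then have "int p dvd int n" by (simp add: in_prime_factors_iff)
  then show "Legendre a (int p) = Legendre b (int p)"
    using assms by (intro Legendre_cong) (rule cong_dvd_modulus)
qed simp

lemma jacobi_eq_0_iff:
  assumes "n > 0"
  shows "jacobi n a = 0 \<longleftrightarrow> \<not> coprime a (int n)"
proof -
  have "jacobi n a = 0 \<longleftrightarrow> (\<exists>p. prime p \<and> p dvd n \<and> int p dvd a)"
    using assms by (auto simp: jacobi_def in_prime_factors_iff Legendre_def cong_0_iff)
  also have "\<dots> \<longleftrightarrow> \<not> coprime a (int n)"
  proof
    assume "\<exists>p. prime p \<and> p dvd n \<and> int p dvd a"
    then obtain p where p: "prime p" "p dvd n" "int p dvd a" by blast
    then have "\<not> is_unit (int p)" by (metis int_dvd_int_iff not_prime_unit of_nat_1)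
    then show "\<not> coprime a (int n)" using p not_coprimeI[of "int p"] by auto
  next
    assume "\<not> coprime a (int n)"
    then have "gcd (nat \<bar>a\<bar>) n \<noteq> 1"
      by (metis coprime_iff_gcd_eq_1 gcd_int_def nat_int of_nat_1 abs_of_nat)
    then obtain p where "prime p" "p dvd gcd (nat \<bar>a\<bar>) n" using prime_factor_nat by blast
    then show "\<exists>p. prime p \<and> p dvd n \<and> int p dvd a" by (auto simp: int_dvd_int_iff[symmetric] simp del: int_dvd_int_iff)
  qed
  finally show ?thesis .
qed

context
  fixes n :: nat
  assumes odd: "odd n"
begin

private lemma prime_factor_gt_2:
  assumes "p \<in> prime_factors n"
  shows "prime p" "p > 2"
proof -
  show p: "prime p" using assms by auto
  have "p \<noteq> 2" using assms odd by auto
  then show "p > 2" using prime_ge_2_nat[OF p] by simp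
qed

lemma jacobi_mult: "jacobi n (a * b) = jacobi n a * jacobi n b"
  unfolding jacobi_def prod.distrib[symmetric]
  by (intro prod.cong refl Legendre_mult) (erule prime_factor_gt_2)+

text \<open>A squarefree \<open>n\<close> is the product of its prime divisors, so multiplying the
  congruences for the Legendre symbols of -1 yields \<open>n\<close> modulo 4, which is 1.\<close>

lemma jacobi_minus_one:
  assumes "squarefree n" and "n mod 4 = 1"
  shows "jacobi n (-1) = 1"
proof (rule cong_unit_imp_eq)
  have "n \<noteq> 0" using odd by (intro notI) auto
  have "n = (\<Prod>p\<in>prime_factors n. p ^ multiplicity p n)"
    using \<open>n \<noteq> 0\<close> by (intro prime_factorization_nat) simp
  also have "\<dots> = (\<Prod>p\<in>prime_factors n. p)"
    using \<open>n \<noteq> 0\<close> assms(1) by (intro prod.cong) (auto simp: squarefree_factorial_semiring')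
  finally have "int n = int (\<Prod>p\<in>prime_factors n. p)" by (rule arg_cong)
  then have "int n = (\<Prod>p\<in>prime_factors n. int p)" by (simp only: of_nat_prod)
  moreover have "[jacobi n (-1) = (\<Prod>p\<in>prime_factors n. int p)] (mod 4)"
    unfolding jacobi_def by (intro cong_prod Legendre_minus_one_cong) (erule prime_factor_gt_2)+
  moreover have "[int n = 1] (mod 4)" using arg_cong[OF assms(2), of int]
    by (simp add: cong_def zmod_int)
  ultimately show "[jacobi n (-1) = 1] (mod 4)" by (simp only: cong_def)
qed (use jacobi_values in auto)

text \<open>The witness is a nonresidue modulo a common prime divisor of \<open>k\<close> and \<open>n\<close>
  which is 1 modulo the cofactor.\<close>

lemma jacobi_primitive:
  assumes "squarefree n" and "\<not> coprime k (int n)"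
  shows "\<exists>b. [b * k = k] (mod int n) \<and> jacobi n b = -1"
proof -
  have "n > 0" using odd by (rule odd_pos)
  have "jacobi n k = 0" using assms(2) jacobi_eq_0_iff \<open>n > 0\<close> by blast
  then obtain p where p: "p \<in> prime_factors n" "Legendre k p = 0"
    by (auto simp: jacobi_def)
  then have "int p dvd k" by (auto simp: Legendre_def cong_0_iff split: if_splits)
  note p' = prime_factor_gt_2[OF p(1)]
  obtain m where m: "n = p * m" using p(1) by auto
  have "coprime p m" proof (rule prime_imp_coprime[OF p'(1)])
    show "\<not> p dvd m"
    proof
      assume "p dvd m"
      then have "p\<^sup>2 dvd n" unfolding m power2_eq_square by (intro mult_dvd_mono) auto
      then show False using squarefreeD[OF assms(1)] p'(1) not_prime_unit by blast
    qed
  qed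
  obtain c where c: "Legendre c p = -1" using exists_Legendre_eq_minus_one p' by blast
  obtain b where b: "[b = c] (mod int p)" "[b = 1] (mod int m)"
    using binary_chinese_remainder_int[of "int p" "int m" c 1] \<open>coprime p m\<close> by auto
  have "int n dvd (b - 1) * k"
    using b(2) \<open>int p dvd k\<close> mult_dvd_mono[of "int m" "b - 1" "int p" k]
    by (simp add: m cong_iff_dvd_diff mult.commute)
  then have "[b * k = k] (mod int n)" by (simp add: cong_iff_dvd_diff algebra_simps)
  moreover have "jacobi n b = -1"
  proof -
    have "Legendre b q = 1" if q: "q \<in> prime_factors n - {p}" for q
    proof -
      have "prime q" using q by auto
      have "q dvd p * m" using q m by auto
      then have "q dvd m" using q p'(1) \<open>prime q\<close>
        by (metis DiffE insertI1 prime_dvd_mult_iff primes_dvd_imp_eq)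
      then have "[b = 1] (mod int q)" using b(2) by (meson cong_dvd_modulus int_dvd_int_iff)
      then have "Legendre b q = Legendre 1 q" by (rule Legendre_cong)
      also have "\<dots> = 1"
      proof -
        have "\<not> [1 = 0] (mod int q)" using \<open>prime q\<close>
          by (metis cong_0_iff int_dvd_int_iff not_prime_unit of_nat_1)
        moreover have "[1\<^sup>2 = 1] (mod int q)" by simp
        ultimately show ?thesis unfolding Legendre_def QuadRes_def by metis
      qed
      finally show ?thesis .
    qed
    then have "(\<Prod>q\<in>prime_factors n - {p}. Legendre b q) = 1" by (intro prod.neutral) blast
    moreover have "Legendre b p = -1" using c Legendre_cong[OF b(1)] by simp
    ultimately show ?thesis
      unfolding jacobi_def using p(1) by (subst prod.remove[of _ p]) auto
  qed
  ultimately show ?thesis by blast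
qed

end

section \<open>Gauss sums of even primitive quadratic characters\<close>

definition unity_root :: "nat \<Rightarrow> int \<Rightarrow> complex" where
  "unity_root n a = cis (2 * pi * of_int a / of_nat n)"

lemma unity_root_0 [simp]: "unity_root n 0 = 1"
  by (simp add: unity_root_def)

lemma unity_root_add: "unity_root n (a + b) = unity_root n a * unity_root n b"
  by (simp add: unity_root_def cis_mult ring_distribs add_divide_distrib)

lemma unity_root_uminus_mult [simp]: "unity_root n (- a) * unity_root n a = 1"
  by (simp flip: unity_root_add)

lemma unity_root_power: "unity_root n a ^ k = unity_root n (a * int k)"
  by (simp add: unity_root_def DeMoivre mult_ac)

lemma unity_root_eq_1_iff:
  assumes "n > 0"
  shows "unity_root n a = 1 \<longleftrightarrow> int n dvd a"
proof -
  have "unity_root n a = 1 \<longleftrightarrow> cos (2 * pi * of_int a / of_nat n) = 1"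
  proof
    assume *: "cos (2 * pi * of_int a / of_nat n) = 1"
    then have "sin (2 * pi * of_int a / of_nat n) = 0"
      using sin_cos_squared_add[of "2 * pi * of_int a / of_nat n"] by simp
    then show "unity_root n a = 1" using * by (simp add: unity_root_def complex_eq_iff)
  qed (simp add: unity_root_def complex_eq_iff)
  also have "\<dots> \<longleftrightarrow> (\<exists>x::int. 2 * pi * of_int a / of_nat n = of_int x * 2 * pi)"
    by (rule cos_one_2pi_int)
  also have "\<dots> \<longleftrightarrow> (\<exists>x::int. a = int n * x)"
  proof (rule ex_cong1)
    fix x :: int
    have "2 * pi * of_int a / of_nat n = of_int x * 2 * pi \<longleftrightarrow> real_of_int a = of_nat n * of_int x"
      using assms by (auto simp: field_simps)
    also have "\<dots> \<longleftrightarrow> real_of_int a = real_of_int (int n * x)" by simp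
    also have "\<dots> \<longleftrightarrow> a = int n * x" by (rule of_int_eq_iff)
    finally show "2 * pi * of_int a / of_nat n = of_int x * 2 * pi \<longleftrightarrow> a = int n * x" .
  qed
  finally show ?thesis by (simp add: dvd_def)
qed

lemma unity_root_eq_iff:
  assumes "n > 0"
  shows "unity_root n a = unity_root n b \<longleftrightarrow> [a = b] (mod int n)"
proof -
  have "unity_root n a = unity_root n b * unity_root n (a - b)"
    by (simp flip: unity_root_add)
  moreover have "unity_root n b \<noteq> 0" by (simp add: unity_root_def)
  ultimately show ?thesis
    using unity_root_eq_1_iff[OF assms, of "a - b"] by (auto simp: cong_iff_dvd_diff)
qed

text \<open>Orthogonality of additive characters: a geometric sum with ratio
  \<open>unity_root n a\<close>.\<close>

lemma sum_unity_root:
  assumes "n > 0"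
  shows "(\<Sum>k\<in>{0..<int n}. unity_root n (k * a)) = (if int n dvd a then of_nat n else 0)"
proof -
  have "(\<Sum>k\<in>{0..<int n}. unity_root n (k * a)) = (\<Sum>k<n. unity_root n a ^ k)"
    by (rule sum.reindex_bij_witness[of _ int nat]) (auto simp: unity_root_power mult.commute)
  also have "\<dots> = (if int n dvd a then of_nat n else 0)"
  proof (cases "int n dvd a")
    case True
    then have "unity_root n a = 1" using unity_root_eq_1_iff[OF assms] by blast
    then show ?thesis using True by simp
  next
    case False
    then have "unity_root n a \<noteq> 1" using unity_root_eq_1_iff[OF assms] by blast
    moreover have "unity_root n a ^ n = 1"
      unfolding unity_root_power using unity_root_eq_1_iff[OF assms] by simp
    ultimately show ?thesis using False by (simp add: geometric_sum)
  qed
  finally show ?thesis .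
qed

text \<open>Multiplication by a unit permutes the residues; periodicity of \<open>h\<close> absorbs
  the reduction modulo \<open>m\<close>.\<close>

lemma sum_residues_mult:
  fixes h :: "int \<Rightarrow> 'a::comm_monoid_add"
  assumes "m > 0" and per: "\<And>a b. [a = b] (mod m) \<Longrightarrow> h a = h b" and "coprime b m"
  shows "(\<Sum>a\<in>{0..<m}. h (a * b)) = (\<Sum>a\<in>{0..<m}. h a)"
proof -
  let ?f = "\<lambda>a. a * b mod m"
  have "inj_on ?f {0..<m}"
  proof (rule inj_onI)
    fix x y assume *: "x \<in> {0..<m}" "y \<in> {0..<m}" "?f x = ?f y"
    then have "[x = y] (mod m)" using assms(3) by (metis cong_def cong_mult_rcancel)
    then show "x = y" using * by (simp add: cong_def)
  qed
  moreover from this have "?f ` {0..<m} = {0..<m}"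
    using assms(1) by (intro endo_inj_surj) auto
  ultimately have "(\<Sum>a\<in>{0..<m}. h a) = (\<Sum>a\<in>{0..<m}. h (?f a))"
    by (metis (no_types, lifting) sum.reindex_cong)
  also have "\<dots> = (\<Sum>a\<in>{0..<m}. h (a * b))" by (intro sum.cong refl per) simp
  finally show ?thesis by simp
qed

text \<open>Collects the properties of the Jacobi symbol from which the factorisation is derived.
  Primitivity is stated through a multiplier \<open>b\<close> that fixes \<open>k\<close> but
  reverses the sign of the character, which is the form that makes the Gauss sum vanish at
  \<open>k\<close>.\<close>

locale even_primitive_character =
  fixes n :: nat and \<chi> :: "int \<Rightarrow> int"
  assumes n_gt_1: "n > 1"
    and odd_n: "odd n"
    and chi_values: "\<chi> a \<in> {-1, 0, 1}"
    and chi_mult: "\<chi> (a * b) = \<chi> a * \<chi> b"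
    and chi_cong: "[a = b] (mod int n) \<Longrightarrow> \<chi> a = \<chi> b"
    and chi_eq_0_iff: "\<chi> a = 0 \<longleftrightarrow> \<not> coprime a (int n)"
    and chi_minus_one: "\<chi> (-1) = 1"
    and chi_primitive: "\<not> coprime k (int n) \<Longrightarrow> \<exists>b. [b * k = k] (mod int n) \<and> \<chi> b = -1"
begin

abbreviation \<zeta> :: "int \<Rightarrow> complex" where "\<zeta> \<equiv> unity_root n"

abbreviation residues :: "int set" where "residues \<equiv> {0..<int n}"

definition gsum :: "int \<Rightarrow> complex" where
  "gsum k = (\<Sum>a\<in>residues. of_int (\<chi> a) * \<zeta> (a * k))"

abbreviation G :: complex where "G \<equiv> gsum 1"

lemma n_pos: "n > 0" using n_gt_1 by simp

lemma zeta_cong: "[a = b] (mod int n) \<Longrightarrow> \<zeta> a = \<zeta> b"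
  using unity_root_eq_iff[OF n_pos] by blast

lemma chi_1 [simp]: "\<chi> 1 = 1"
  using chi_mult[of 1 1] chi_eq_0_iff[of 1] by auto

lemma chi_minus [simp]: "\<chi> (- a) = \<chi> a"
  using chi_mult[of "-1" a] by (simp add: chi_minus_one)

lemma chi_square: "coprime a (int n) \<Longrightarrow> \<chi> a * \<chi> a = 1"
  using chi_values[of a] chi_eq_0_iff[of a] by auto

text \<open>Replacing \<open>a\<close> by \<open>a * b\<close> for a unit \<open>b\<close> gives
  \<open>gsum k = \<chi> b * gsum (b * k)\<close>. For a unit \<open>k\<close>, take
  \<open>b\<close> to be \<open>k\<close> and evaluate at 1; otherwise the \<open>b\<close> from
  primitivity gives \<open>gsum k = - gsum k\<close>.\<close>

lemma gsum_eq: "gsum k = of_int (\<chi> k) * G"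
proof -
  have sub: "gsum k = of_int (\<chi> b) * gsum (b * k)" if "coprime b (int n)" for b k
  proof -
    have "gsum k = (\<Sum>a\<in>residues. of_int (\<chi> (a * b)) * \<zeta> (a * b * k))"
      unfolding gsum_def
    proof (rule sum_residues_mult[symmetric])
      show "of_int (\<chi> a) * \<zeta> (a * k) = of_int (\<chi> c) * \<zeta> (c * k)"
        if "[a = c] (mod int n)" for a c
        using chi_cong[OF that] zeta_cong[OF cong_scalar_right[OF that, of k]] by simp
    qed (use that n_pos in auto)
    also have "\<dots> = of_int (\<chi> b) * gsum (b * k)"
      by (simp add: gsum_def sum_distrib_left chi_mult mult_ac)
    finally show ?thesis .
  qed
  show ?thesis
  proof (cases "coprime k (int n)")
    case True
    then show ?thesis using sub[of k 1] chi_square[of k]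
      by (metis mult.assoc mult.left_neutral mult.right_neutral of_int_1 of_int_mult)
  next
    case False
    then obtain b where b: "[b * k = k] (mod int n)" "\<chi> b = -1" using chi_primitive by blast
    then have "coprime b (int n)" using chi_eq_0_iff[of b] by auto
    then have "gsum k = of_int (\<chi> b) * gsum (b * k)" by (rule sub)
    also have "gsum (b * k) = gsum k"
      unfolding gsum_def
    proof (intro sum.cong refl arg_cong2[where f = "(*)"] zeta_cong)
      fix a show "[a * (b * k) = a * k] (mod int n)" using b(1) by (rule cong_scalar_left)
    qed
    finally show ?thesis using b(2) False chi_eq_0_iff[of k] by simp
  qed
qed

lemma sum_chi_square: "(\<Sum>a\<in>residues. \<chi> a * \<chi> a) = int (card {a\<in>residues. \<chi> a \<noteq> 0})"
proof -
  have "\<chi> a * \<chi> a = (if \<chi> a \<noteq> 0 then 1 else 0)" for a using chi_values[of a] by auto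
  then have "(\<Sum>a\<in>residues. \<chi> a * \<chi> a) = (\<Sum>a\<in>residues. if \<chi> a \<noteq> 0 then 1 else 0)" by simp
  also have "\<dots> = int (card {a\<in>residues. \<chi> a \<noteq> 0})" by (simp add: sum.If_cases Int_def)
  finally show ?thesis .
qed

text \<open>Double evaluation of the sum of \<open>gsum k * gsum (- k)\<close>: the previous lemma
  and evenness give \<open>G\<^sup>2\<close> times the sum of the squares of \<open>\<chi>\<close>,
  while expansion and orthogonality give \<open>n\<close> times the same nonzero sum.\<close>

lemma G_square: "G\<^sup>2 = of_nat n"
proof -
  let ?S = "\<Sum>a\<in>residues. \<chi> a * \<chi> a"
  have "(\<Sum>k\<in>residues. gsum k * gsum (- k)) = (\<Sum>k\<in>residues. of_int (\<chi> k * \<chi> k) * G\<^sup>2)"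
    by (intro sum.cong refl, subst (1 2) gsum_eq) (simp add: power2_eq_square)
  also have "\<dots> = of_int ?S * G\<^sup>2" by (simp add: sum_distrib_right)
  finally have lhs: "(\<Sum>k\<in>residues. gsum k * gsum (- k)) = of_int ?S * G\<^sup>2" .
  have "(\<Sum>k\<in>residues. gsum k * gsum (- k)) =
    (\<Sum>k\<in>residues. \<Sum>a\<in>residues. \<Sum>b\<in>residues. of_int (\<chi> a * \<chi> b) * \<zeta> (k * (a - b)))"
    unfolding gsum_def sum_product
  proof (intro sum.cong refl)
    fix k a b
    have "\<zeta> (k * (a - b)) = \<zeta> (a * k) * \<zeta> (b * - k)"
      by (simp add: algebra_simps flip: unity_root_add)
    then show "of_int (\<chi> a) * \<zeta> (a * k) * (of_int (\<chi> b) * \<zeta> (b * - k)) =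
      of_int (\<chi> a * \<chi> b) * \<zeta> (k * (a - b))" by simp
  qed
  also have "\<dots> = (\<Sum>a\<in>residues. \<Sum>b\<in>residues. of_int (\<chi> a * \<chi> b) * (\<Sum>k\<in>residues. \<zeta> (k * (a - b))))"
    by (subst sum.swap, rule sum.cong[OF refl], subst sum.swap) (simp add: sum_distrib_left)
  also have "\<dots> = (\<Sum>a\<in>residues. \<Sum>b\<in>residues. if b = a then of_int (\<chi> a * \<chi> a) * of_nat n else 0)"
  proof (intro sum.cong refl)
    fix a b assume ab: "a \<in> residues" "b \<in> residues"
    have "int n dvd a - b \<longleftrightarrow> b = a"
      using ab by (auto simp: cong_def simp flip: cong_iff_dvd_diff)
    then show "of_int (\<chi> a * \<chi> b) * (\<Sum>k\<in>residues. \<zeta> (k * (a - b))) =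
      (if b = a then of_int (\<chi> a * \<chi> a) * of_nat n else 0)"
      using sum_unity_root[OF n_pos, of "a - b"] by simp
  qed
  also have "\<dots> = of_int ?S * of_nat n" by (simp add: sum_distrib_right)
  finally have "of_int ?S * G\<^sup>2 = of_int ?S * of_nat n" using lhs by simp
  moreover have "?S \<noteq> 0"
  proof -
    have "1 \<in> {a\<in>residues. \<chi> a \<noteq> 0}" using n_gt_1 by simp
    moreover have "finite {a\<in>residues. \<chi> a \<noteq> 0}"
      by (rule finite_subset[of _ residues]) auto
    ultimately have "card {a\<in>residues. \<chi> a \<noteq> 0} \<noteq> 0" by (metis card_0_eq empty_iff)
    then show ?thesis unfolding sum_chi_square by simp
  qed
  ultimately show ?thesis by (metis mult_left_cancel of_int_eq_0_iff)
qed

lemma G_neq_0: "G \<noteq> 0"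
  using G_square n_pos by auto

text \<open>This sum is \<open>gsum 0\<close>, and 0 is not a unit modulo \<open>n\<close>.\<close>

lemma sum_chi: "(\<Sum>a\<in>residues. \<chi> a) = 0"
proof -
  have "gsum 0 = 0" using gsum_eq[of 0] chi_eq_0_iff[of 0] n_gt_1 by simp
  then have "complex_of_int (\<Sum>a\<in>residues. \<chi> a) = 0" by (simp add: gsum_def)
  then show ?thesis by (simp only: of_int_eq_0_iff)
qed

text \<open>Expanding one factor of \<open>\<chi>\<^sup>2\<close> by \<open>\<chi>(a) G = gsum a\<close> shows that Ramanujan sums are
  integral without any use of the Galois action.\<close>

lemma ramanujan_sum:
  "(\<Sum>a\<in>residues. of_int (\<chi> a * \<chi> a) * \<zeta> (a * k)) = of_int (\<Sum>b\<in>residues. \<chi> b * \<chi> (b + k))"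
proof -
  have "G * (\<Sum>a\<in>residues. of_int (\<chi> a * \<chi> a) * \<zeta> (a * k)) =
    (\<Sum>a\<in>residues. of_int (\<chi> a) * gsum a * \<zeta> (a * k))"
    unfolding sum_distrib_left by (intro sum.cong refl, subst gsum_eq) simp
  also have "\<dots> = (\<Sum>a\<in>residues. \<Sum>b\<in>residues. of_int (\<chi> b) * (of_int (\<chi> a) * \<zeta> (a * (b + k))))"
    unfolding gsum_def sum_distrib_left sum_distrib_right
    by (intro sum.cong refl) (simp add: unity_root_add ring_distribs mult_ac)
  also have "\<dots> = (\<Sum>b\<in>residues. of_int (\<chi> b) * gsum (b + k))"
    by (subst sum.swap) (simp add: gsum_def sum_distrib_left)
  also have "\<dots> = G * of_int (\<Sum>b\<in>residues. \<chi> b * \<chi> (b + k))"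
    unfolding of_int_sum sum_distrib_left by (intro sum.cong refl, subst gsum_eq) simp
  finally show ?thesis using G_neq_0 by simp
qed

end

section \<open>Rational cyclotomic integers\<close>

text \<open>In the rational vector space \<complex> the set \<open>{1}\<close> is independent, so
  the value 1 at 1 extends linearly. Additivity is phrased with differences to match the rules of
  \<open>cyclotomic_integers\<close>.\<close>

lemma exists_rat_functional:
  "\<exists>\<phi>::complex \<Rightarrow> rat. (\<forall>x y. \<phi> (x - y) = \<phi> x - \<phi> y) \<and> (\<forall>q x. \<phi> (of_rat q * x) = q * \<phi> x) \<and> \<phi> 1 = 1"
proof -
  interpret vector_space_pair "\<lambda>q x. of_rat q * x :: complex" "(*) :: rat \<Rightarrow> rat \<Rightarrow> rat"
    by unfold_locales (simp_all add: ring_distribs of_rat_add of_rat_mult mult.assoc)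
  have "vs1.independent {1}" by simp
  then obtain \<phi> where "Vector_Spaces.linear (\<lambda>q x. of_rat q * x :: complex) ((*) :: rat \<Rightarrow> rat \<Rightarrow> rat) \<phi>" and 1: "\<phi> 1 = 1"
    using linear_independent_extend[of "{1}" "\<lambda>_. 1"] by auto
  then interpret Vector_Spaces.linear "\<lambda>q x. of_rat q * x :: complex" "(*) :: rat \<Rightarrow> rat \<Rightarrow> rat" \<phi> by simp
  show ?thesis using 1 diff scale by blast
qed

lemma common_denominator:
  assumes "finite (X :: rat set)"
  shows "\<exists>d>0. \<forall>x\<in>X. of_nat d * x \<in> \<int>"
  using assms
proof induction
  case (insert x X)
  then obtain d where d: "d > 0" "\<And>x. x \<in> X \<Longrightarrow> of_nat d * x \<in> \<int>" by blast
  obtain p q where pq: "q > 0" "x = of_int p / of_int q" by (meson quotient_of_denom_pos quotient_of_div surj_pair)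
  have "of_nat (nat q * d) * y \<in> \<int>" if "y \<in> insert x X" for y
  proof (cases "y = x")
    case True
    then have "of_nat (nat q * d) * y = of_int (int d * p)" using pq by simp
    then show ?thesis by (metis Ints_of_int)
  next
    case False
    then have "of_nat d * y \<in> \<int>" using d(2) that by blast
    then have "of_nat (nat q) * (of_nat d * y) \<in> \<int>" by (rule Ints_mult[OF Ints_of_nat])
    moreover have "of_nat (nat q * d) * y = of_nat (nat q) * (of_nat d * y)" by simp
    ultimately show ?thesis by (simp only:)
  qed
  moreover have "nat q * d > 0" using d(1) pq(1) by simp
  ultimately show ?case by blast
qed (auto intro: exI[of _ 1])

text \<open>If \<open>q\<close> is the reduced denominator of \<open>r\<close>, then every power of
  \<open>q\<close> divides \<open>d\<close>, so \<open>q\<close> must be 1.\<close>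

lemma rat_bounded_denominator_powers:
  fixes r :: rat
  assumes "d > 0" and "\<And>k. of_nat d * r ^ k \<in> \<int>"
  shows "r \<in> \<int>"
proof -
  obtain p q where pq: "quotient_of r = (p, q)" by fastforce
  then have q: "q > 0" "coprime p q" and r: "r = of_int p / of_int q"
    by (auto dest: quotient_of_denom_pos quotient_of_coprime quotient_of_div)
  \<comment> \<open>The exponent \<open>d\<close> suffices: \<open>q ^ d\<close> divides
    \<open>d\<close>, and \<open>d < 2 ^ d\<close> leaves no room for
    \<open>q \<ge> 2\<close>.\<close>
  obtain m where "of_nat d * r ^ d = of_int m" using assms(2)[of d] by (elim Ints_cases)
  then have "(of_int (int d * p ^ d) :: rat) = of_int (m * q ^ d)"
    using q(1) by (simp add: r field_simps)
  then have "int d * p ^ d = m * q ^ d" by (simp only: of_int_eq_iff)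
  then have "q ^ d dvd int d * p ^ d" by simp
  moreover have "coprime (q ^ d) (p ^ d)" using q(2) by (simp add: coprime_commute)
  ultimately have "q ^ d dvd int d" by (simp add: coprime_dvd_mult_left_iff)
  then have "q ^ d \<le> int d" using assms(1) by (intro zdvd_imp_le) auto
  moreover have "int d < 2 ^ d" by (simp add: of_nat_less_two_power)
  ultimately have "\<not> q \<ge> 2" using power_mono[of 2 q d] by linarith
  then have "q = 1" using q(1) by simp
  then show ?thesis by (simp add: r)
qed

text \<open>The ring \<int>[\<zeta>], presented as the additive group generated by the roots of
  unity. This keeps inductions additive; closure under products is proved separately.\<close>

inductive_set cyclotomic_integers :: "nat \<Rightarrow> complex set" for n where
  zero: "0 \<in> cyclotomic_integers n"
| root: "unity_root n a \<in> cyclotomic_integers n"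
| diff: "x \<in> cyclotomic_integers n \<Longrightarrow> y \<in> cyclotomic_integers n \<Longrightarrow> x - y \<in> cyclotomic_integers n"

lemma cyclotomic_integers_1: "1 \<in> cyclotomic_integers n"
  using cyclotomic_integers.root[of n 0] by simp

lemma cyclotomic_integers_minus: "x \<in> cyclotomic_integers n \<Longrightarrow> - x \<in> cyclotomic_integers n"
  using cyclotomic_integers.diff[OF cyclotomic_integers.zero] by fastforce

lemma cyclotomic_integers_add:
  "x \<in> cyclotomic_integers n \<Longrightarrow> y \<in> cyclotomic_integers n \<Longrightarrow> x + y \<in> cyclotomic_integers n"
  using cyclotomic_integers.diff[of x n "- y"] cyclotomic_integers_minus by simp

lemma cyclotomic_integers_mult:
  assumes "x \<in> cyclotomic_integers n" and "y \<in> cyclotomic_integers n"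
  shows "x * y \<in> cyclotomic_integers n"
  using assms(1)
proof induction
  case (root a)
  show ?case using assms(2)
  proof induction
    case (root b)
    then show ?case using cyclotomic_integers.root[of n "a + b"] by (simp add: unity_root_add)
  qed (auto simp: right_diff_distrib intro: cyclotomic_integers.intros)
qed (auto simp: left_diff_distrib intro: cyclotomic_integers.intros)

lemma cyclotomic_integers_power: "x \<in> cyclotomic_integers n \<Longrightarrow> x ^ k \<in> cyclotomic_integers n"
  by (induction k) (auto intro: cyclotomic_integers_1 cyclotomic_integers_mult)

text \<open>A \<open>\<rat>\<close>-linear functional on \<open>\<complex>\<close> fixing 1 has bounded denominators on the finitely generated
  group \<open>\<int>[\<zeta>]\<close>, hence so do the powers of any rational number in \<open>\<int>[\<zeta>]\<close>.\<close>

lemma rational_cyclotomic_integer_is_int: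
  assumes "n > 0" and "x \<in> cyclotomic_integers n" and "x \<in> \<rat>"
  shows "x \<in> \<int>"
proof -
  obtain \<phi> :: "complex \<Rightarrow> rat" where phi: "\<And>x y. \<phi> (x - y) = \<phi> x - \<phi> y"
    "\<And>q x. \<phi> (of_rat q * x) = q * \<phi> x" "\<phi> 1 = 1"
    using exists_rat_functional by blast
  obtain d where d: "d > 0" "\<And>a. a \<in> {0..<int n} \<Longrightarrow> of_nat d * \<phi> (unity_root n a) \<in> \<int>"
    using common_denominator[of "(\<lambda>a. \<phi> (unity_root n a)) ` {0..<int n}"] by auto
  have *: "of_nat d * \<phi> y \<in> \<int>" if "y \<in> cyclotomic_integers n" for y
    using that
  proof induction
    case zero
    have "\<phi> 0 = 0" using phi(1)[of 0 0] by simp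
    then show ?case by simp
  next
    case (root a)
    have "unity_root n a = unity_root n (a mod int n)"
      using unity_root_eq_iff[OF assms(1)] by simp
    then show ?case using d(2)[of "a mod int n"] assms(1) by simp
  next
    case (diff x y)
    then show ?case by (simp add: phi(1) right_diff_distrib)
  qed
  obtain r where r: "x = of_rat r" using assms(3) by (elim Rats_cases)
  have "of_nat d * r ^ k \<in> \<int>" for k
  proof -
    have "\<phi> (x ^ k) = r ^ k" using phi(2)[of "r ^ k" 1] phi(3) by (simp add: r of_rat_power)
    then show ?thesis using *[OF cyclotomic_integers_power[OF assms(2)], of k] by simp
  qed
  then have "r \<in> \<int>" by (rule rat_bounded_denominator_powers[OF d(1)])
  then show ?thesis by (auto simp: r elim!: Ints_cases)
qed

section \<open>Coefficients of products of linear factors and Newton's identities\<close>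

lemma coeff_prod_in_cyclotomic_integers:
  assumes "\<And>a. a \<in> A \<Longrightarrow> c a \<in> cyclotomic_integers n"
  shows "coeff (\<Prod>a\<in>A. [:1, - c a:]) k \<in> cyclotomic_integers n"
  using assms
proof (induction A arbitrary: k rule: infinite_finite_induct)
  case (insert a A)
  then have "coeff (\<Prod>a\<in>A. [:1, - c a:]) k \<in> cyclotomic_integers n" for k by blast
  moreover have "c a \<in> cyclotomic_integers n" using insert.prems by simp
  ultimately show ?case using insert.hyps
    by (cases k) (auto intro!: cyclotomic_integers.diff cyclotomic_integers_mult)
qed (auto simp: cyclotomic_integers_1 cyclotomic_integers.zero coeff_1)

text \<open>Logarithmic differentiation: a factor 1 - c X contributes -c / (1 - c X), whose
  geometric series has the negated powers of c as coefficients.\<close>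

lemma newton_fps:
  fixes c :: "'b \<Rightarrow> 'a::idom"
  assumes "finite A"
  shows "fps_deriv (\<Prod>a\<in>A. 1 - fps_const (c a) * fps_X) =
    - (\<Prod>a\<in>A. 1 - fps_const (c a) * fps_X) * Abs_fps (\<lambda>i. \<Sum>a\<in>A. c a ^ Suc i)"
  using assms
proof induction
  case empty
  then show ?case by (simp add: fps_eq_iff)
next
  case (insert b A)
  define F where "F = (\<Prod>a\<in>A. 1 - fps_const (c a) * fps_X)"
  define S where "S = Abs_fps (\<lambda>i. \<Sum>a\<in>A. c a ^ Suc i)"
  define T where "T = Abs_fps (\<lambda>i. c b ^ Suc i)"
  define L where "L = 1 - fps_const (c b) * fps_X"
  \<comment> \<open>Expresses T = c / (1 - c X) without a division, so an integral domain is
    enough.\<close>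
  have LT: "L * T = fps_const (c b)"
  proof (rule fps_ext)
    fix i show "fps_nth (L * T) i = fps_nth (fps_const (c b)) i"
      by (cases i) (simp_all add: L_def T_def left_diff_distrib mult.assoc)
  qed
  have "Abs_fps (\<lambda>i. \<Sum>a\<in>insert b A. c a ^ Suc i) = T + S"
    using insert.hyps by (simp add: fps_eq_iff S_def T_def)
  moreover have "fps_deriv (L * F) = - (L * F) * (T + S)"
  proof -
    have "fps_deriv (L * F) = L * fps_deriv F + fps_deriv L * F" by simp
    also have "fps_deriv L = - (L * T)" by (simp add: LT) (simp add: L_def)
    also have "fps_deriv F = - F * S" using insert.IH by (simp add: F_def S_def)
    finally show ?thesis by (simp add: algebra_simps)
  qed
  ultimately show ?case using insert.hyps by (simp add: L_def F_def)
qed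

text \<open>Comparison of coefficients in \<open>newton_fps\<close>. In characteristic 0 it
  determines the coefficients recursively from the power sums.\<close>

lemma newton_coeff:
  fixes c :: "'b \<Rightarrow> 'a::idom"
  assumes "finite A"
  defines "p \<equiv> \<Prod>a\<in>A. [:1, - c a:]"
  shows "of_nat (Suc k) * coeff p (Suc k) = - (\<Sum>i\<le>k. coeff p i * (\<Sum>a\<in>A. c a ^ Suc (k - i)))"
proof -
  have p: "fps_of_poly p = (\<Prod>a\<in>A. 1 - fps_const (c a) * fps_X)"
    by (simp add: p_def fps_of_poly_prod fps_of_poly_pCons flip: fps_const_neg)
  have "of_nat (Suc k) * coeff p (Suc k) = fps_nth (fps_deriv (fps_of_poly p)) k" by simp
  also have "\<dots> = - (\<Sum>i\<le>k. coeff p i * (\<Sum>a\<in>A. c a ^ Suc (k - i)))"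
    unfolding p newton_fps[OF assms(1)] unfolding p[symmetric]
    by (simp add: fps_mult_nth atLeast0AtMost sum_negf)
  finally show ?thesis .
qed

section \<open>Gauss's formula for the cyclotomic polynomial\<close>

text \<open>The square of the reduced denominator of \<open>r\<close> divides \<open>n\<close>, so
  that denominator is 1.\<close>

lemma rational_root_of_squarefree_int:
  fixes r :: rat
  assumes "squarefree n" and "of_nat n * r\<^sup>2 \<in> \<int>"
  shows "r \<in> \<int>"
proof -
  obtain p q where pq: "quotient_of r = (p, q)" by fastforce
  then have q: "q > 0" "coprime p q" and r: "r = of_int p / of_int q"
    by (auto dest: quotient_of_denom_pos quotient_of_coprime quotient_of_div)
  obtain m where "of_nat n * r\<^sup>2 = of_int m" using assms(2) by (elim Ints_cases)
  then have "(of_int (int n * p\<^sup>2) :: rat) = of_int (m * q\<^sup>2)"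
    using q(1) by (simp add: r field_simps)
  then have "int n * p\<^sup>2 = m * q\<^sup>2" by (simp only: of_int_eq_iff)
  then have "q\<^sup>2 dvd int n * p\<^sup>2" by simp
  moreover have "coprime (q\<^sup>2) (p\<^sup>2)" using q(2) by (simp add: coprime_commute)
  ultimately have "q\<^sup>2 dvd int n" by (simp add: coprime_dvd_mult_left_iff)
  then have "int ((nat q)\<^sup>2) dvd int n" using q(1) by simp
  then have "(nat q)\<^sup>2 dvd n" by (simp only: int_dvd_int_iff)
  then have "is_unit (nat q)" using squarefreeD[OF assms(1)] by blast
  then have "q = 1" using q(1) by simp
  then show ?thesis by (simp add: r)
qed

lemma integral_complex_poly:
  fixes p :: "complex poly"
  assumes "\<And>k. coeff p k \<in> \<int>"
  obtains q :: "int poly" where "map_poly of_int q = p"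
proof
  show "map_poly of_int (map_poly (\<lambda>x. \<lfloor>Re x\<rfloor>) p) = p"
  proof (rule poly_eqI)
    fix k
    obtain m where "coeff p k = of_int m" using assms[of k] by (elim Ints_cases)
    then show "coeff (map_poly of_int (map_poly (\<lambda>x. \<lfloor>Re x\<rfloor>) p)) k = coeff p k"
      by (simp add: coeff_map_poly)
  qed
qed

text \<open>Here \<open>d\<close> is a formal degree: the coefficients at both ends may vanish, as
  happens for the difference of the two class polynomials.\<close>

definition palindromic :: "nat \<Rightarrow> 'a::zero poly \<Rightarrow> bool" where
  "palindromic d p \<longleftrightarrow> (\<forall>i>d. coeff p i = 0) \<and> (\<forall>i\<le>d. coeff p (d - i) = coeff p i)"

lemma palindromicI_reflect_poly:
  assumes "reflect_poly p = p"
  shows "palindromic (degree p) p"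
  unfolding palindromic_def
proof (intro conjI allI impI)
  fix i assume "i \<le> degree p"
  then show "coeff p (degree p - i) = coeff p i"
    using coeff_reflect_poly[of p i] assms by simp
qed (simp add: coeff_eq_0)

lemma palindromic_of_int:
  assumes "palindromic d (map_poly of_int p :: 'a::ring_char_0 poly)"
  shows "palindromic d p"
  using assms by (simp add: palindromic_def coeff_map_poly)

lemma primitive_roots_of_unity_eq:
  assumes "n > 0"
  shows "primitive_roots_of_unity n = unity_root n ` {a\<in>{0..<int n}. coprime a (int n)}"
proof -
  have root: "{z. z ^ n = 1} = unity_root n ` {0..<int n}"
  proof -
    have "{z. z ^ n = 1} = (\<lambda>k. cis (2 * pi * real k / real n)) ` {..<n}"
      using bij_betw_roots_unity[OF assms] by (simp add: bij_betw_def)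
    also have "\<dots> = unity_root n ` int ` {..<n}"
      unfolding image_image by (simp add: unity_root_def)
    also have "int ` {..<n} = {0..<int n}"
      using image_int_atLeastLessThan[of 0 n] by (simp add: atLeast0LessThan)
    finally show ?thesis .
  qed
  have prim: "(\<forall>m. 0 < m \<and> m < n \<longrightarrow> unity_root n a ^ m \<noteq> 1) \<longleftrightarrow> coprime a (int n)" for a
  proof -
    have pow: "unity_root n a ^ m = 1 \<longleftrightarrow> int n dvd a * int m" for m
      by (simp add: unity_root_power unity_root_eq_1_iff[OF assms])
    show ?thesis
    proof
      assume *: "\<forall>m. 0 < m \<and> m < n \<longrightarrow> unity_root n a ^ m \<noteq> 1"
      \<comment> \<open>The cofactor \<open>m\<close> of \<open>g\<close> in \<open>n\<close>
        satisfies \<open>unity_root n a ^ m = 1\<close>; by assumption it is not below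
        \<open>n\<close>, so \<open>g\<close> is 1.\<close>
      define g where "g = nat (gcd a (int n))"
      have g: "int g = gcd a (int n)" by (simp add: g_def)
      then have "g dvd n" by (metis gcd_dvd2 int_dvd_int_iff)
      then obtain m where m: "n = g * m" by (elim dvdE)
      have "int g dvd a" by (simp add: g)
      then have "int n dvd a * int m" by (simp add: m mult_dvd_mono)
      then have "\<not> (0 < m \<and> m < n)" using * pow by blast
      moreover have "m > 0" "g > 0" using m assms by (auto intro: Nat.gr0I)
      ultimately have "g = 1" using m by (metis One_nat_def Suc_lessI n_less_n_mult_m mult.commute)
      then show "coprime a (int n)" using g by (simp add: coprime_iff_gcd_eq_1)
    next
      assume "coprime a (int n)"
      then show "\<forall>m. 0 < m \<and> m < n \<longrightarrow> unity_root n a ^ m \<noteq> 1"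
        unfolding pow by (auto simp: coprime_dvd_mult_right_iff coprime_commute dest: zdvd_imp_le)
    qed
  qed
  have "primitive_roots_of_unity n =
    {z \<in> {z. z ^ n = 1}. \<forall>m. 0 < m \<and> m < n \<longrightarrow> z ^ m \<noteq> 1}"
    by (simp add: primitive_roots_of_unity_def)
  also have "\<dots> = unity_root n ` {a\<in>{0..<int n}. coprime a (int n)}"
    unfolding root using prim by blast
  finally show ?thesis .
qed

text \<open>Totatives are taken from 1 to \<open>n\<close>, residues from 0 to \<open>n - 1\<close>.
  For \<open>n > 1\<close> neither \<open>n\<close> nor 0 is coprime to \<open>n\<close>, so the two
  sets correspond.\<close>

lemma totient_eq_card_residues:
  assumes "n > 1"
  shows "totient n = card {a\<in>{0..<int n}. coprime a (int n)}"
proof -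
  have "bij_betw int (totatives n) {a\<in>{0..<int n}. coprime a (int n)}"
  proof (rule bij_betwI[of _ _ _ nat])
    show "int \<in> totatives n \<rightarrow> {a\<in>{0..<int n}. coprime a (int n)}"
    proof
      fix k assume k: "k \<in> totatives n"
      then have "k \<noteq> n" using assms by (auto simp: totatives_def)
      then show "int k \<in> {a\<in>{0..<int n}. coprime a (int n)}" using k by (simp add: totatives_def)
    qed
    show "nat \<in> {a\<in>{0..<int n}. coprime a (int n)} \<rightarrow> totatives n"
    proof
      fix a assume a: "a \<in> {a\<in>{0..<int n}. coprime a (int n)}"
      then have "a \<noteq> 0" using assms by auto
      moreover have "coprime (int (nat a)) (int n)" using a by simp
      then have "coprime (nat a) n" by (simp only: coprime_int_iff)
      ultimately show "nat a \<in> totatives n" using a by (auto simp: totatives_def)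
    qed
  qed auto
  then show ?thesis unfolding totient_def by (rule bij_betw_same_card)
qed

section \<open>The two class polynomials and their power sums\<close>

context even_primitive_character
begin

definition chi_class :: "int \<Rightarrow> int set" where
  "chi_class s = {a\<in>residues. \<chi> a = s}"

text \<open>Representatives of the pairs \<open>a\<close>, \<open>n - a\<close>. As \<open>n\<close>
  is odd, no residue is its own partner.\<close>

definition half_class :: "int \<Rightarrow> int set" where
  "half_class s = {a\<in>chi_class s. 2 * a < int n}"

text \<open>Normalised to constant term 1, where Newton's recursion starts.
  \<open>class_poly_half\<close> shows that the product of the monic factors is the same.\<close>

definition class_poly :: "int \<Rightarrow> complex poly" where
  "class_poly s = (\<Prod>a\<in>chi_class s. [:1, - \<zeta> a:])"

lemma finite_chi_class [simp]: "finite (chi_class s)"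
  unfolding chi_class_def by (rule finite_subset[of _ residues]) auto

lemma finite_half_class [simp]: "finite (half_class s)"
  unfolding half_class_def by (rule finite_subset[of _ "chi_class s"]) auto

text \<open>For s = 1 or -1 the indicator of \<open>\<chi> a = s\<close> is (\<chi>(a)^2 + s
  \<chi>(a)) / 2. The first term gives an integral Ramanujan sum, the second a Gauss sum.\<close>

lemma class_power_sum:
  assumes "s \<in> {1, -1}"
  shows "(\<Sum>a\<in>chi_class s. \<zeta> (a * k)) =
    (of_int (\<Sum>b\<in>residues. \<chi> b * \<chi> (b + k)) + of_int s * of_int (\<chi> k) * G) / 2"
proof -
  have "(\<Sum>a\<in>chi_class s. \<zeta> (a * k)) = (\<Sum>a\<in>residues. if \<chi> a = s then \<zeta> (a * k) else 0)"
    unfolding chi_class_def by (rule sum.inter_filter) simp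
  also have "\<dots> = (\<Sum>a\<in>residues.
    (of_int (\<chi> a * \<chi> a) * \<zeta> (a * k) + of_int s * (of_int (\<chi> a) * \<zeta> (a * k))) / 2)"
  proof (intro sum.cong refl)
    fix a
    show "(if \<chi> a = s then \<zeta> (a * k) else 0) =
      (of_int (\<chi> a * \<chi> a) * \<zeta> (a * k) + of_int s * (of_int (\<chi> a) * \<zeta> (a * k))) / 2"
      using chi_values[of a] assms by auto
  qed
  also have "\<dots> = ((\<Sum>a\<in>residues. of_int (\<chi> a * \<chi> a) * \<zeta> (a * k)) + of_int s * gsum k) / 2"
    unfolding gsum_def sum_divide_distrib[symmetric] sum.distrib sum_distrib_left[symmetric] ..
  finally show ?thesis unfolding ramanujan_sum gsum_eq[of k] by (simp add: mult.assoc)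
qed

text \<open>The two numbers are conjugate in \<open>\<rat>(G) = \<rat>(\<surd>n)\<close>.\<close>

definition conjugate_pair :: "complex \<Rightarrow> complex \<Rightarrow> bool" where
  "conjugate_pair x y \<longleftrightarrow> (\<exists>u\<in>\<rat>. \<exists>v\<in>\<rat>. x = u + v * G \<and> y = u - v * G)"

lemma conjugate_pair_rational: "u \<in> \<rat> \<Longrightarrow> conjugate_pair u u"
  unfolding conjugate_pair_def by (intro bexI[of _ u] bexI[of _ 0]) auto

lemma conjugate_pair_add:
  assumes "conjugate_pair x y" and "conjugate_pair x' y'"
  shows "conjugate_pair (x + x') (y + y')"
proof -
  obtain u v u' v' where *: "u \<in> \<rat>" "v \<in> \<rat>" "x = u + v * G" "y = u - v * G"
    "u' \<in> \<rat>" "v' \<in> \<rat>" "x' = u' + v' * G" "y' = u' - v' * G"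
    using assms unfolding conjugate_pair_def by blast
  show ?thesis unfolding conjugate_pair_def
    by (intro bexI[of _ "u + u'"] bexI[of _ "v + v'"]) (use * in \<open>auto simp: algebra_simps\<close>)
qed

lemma conjugate_pair_mult:
  assumes "conjugate_pair x y" and "conjugate_pair x' y'"
  shows "conjugate_pair (x * x') (y * y')"
proof -
  obtain u v u' v' where *: "u \<in> \<rat>" "v \<in> \<rat>" "x = u + v * G" "y = u - v * G"
    "u' \<in> \<rat>" "v' \<in> \<rat>" "x' = u' + v' * G" "y' = u' - v' * G"
    using assms unfolding conjugate_pair_def by blast
  have G: "of_nat n = G * G" using G_square by (simp add: power2_eq_square)
  have "x * x' = (u * u' + v * v' * of_nat n) + (u * v' + v * u') * G"
    "y * y' = (u * u' + v * v' * of_nat n) - (u * v' + v * u') * G"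
    unfolding *(3,4,7,8) G by (simp_all add: algebra_simps)
  then show ?thesis unfolding conjugate_pair_def
    by (intro bexI[of _ "u * u' + v * v' * of_nat n"] bexI[of _ "u * v' + v * u'"])
       (use * in auto)
qed

lemma conjugate_pair_sum:
  "(\<And>i. i \<in> I \<Longrightarrow> conjugate_pair (f i) (g i)) \<Longrightarrow> conjugate_pair (sum f I) (sum g I)"
  by (induction I rule: infinite_finite_induct)
     (auto intro: conjugate_pair_rational conjugate_pair_add)

lemma conjugate_pair_power_sums:
  "conjugate_pair (\<Sum>a\<in>chi_class 1. \<zeta> a ^ k) (\<Sum>a\<in>chi_class (-1). \<zeta> a ^ k)"
  unfolding conjugate_pair_def
proof (intro bexI conjI)
  show "(\<Sum>a\<in>chi_class 1. \<zeta> a ^ k) =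
    of_int (\<Sum>b\<in>residues. \<chi> b * \<chi> (b + int k)) / 2 + of_int (\<chi> k) / 2 * G"
    by (subst unity_root_power, subst class_power_sum) (simp_all add: field_simps)
  show "(\<Sum>a\<in>chi_class (-1). \<zeta> a ^ k) =
    of_int (\<Sum>b\<in>residues. \<chi> b * \<chi> (b + int k)) / 2 - of_int (\<chi> k) / 2 * G"
    by (subst unity_root_power, subst class_power_sum) (simp_all add: field_simps)
  show "of_int (\<Sum>b\<in>residues. \<chi> b * \<chi> (b + int k)) / 2 \<in> (\<rat> :: complex set)"
    by (intro Rats_divide Rats_of_int Rats_number_of)
  show "of_int (\<chi> k) / 2 \<in> (\<rat> :: complex set)"
    by (intro Rats_divide Rats_of_int Rats_number_of)
qed

section \<open>Conjugacy and integrality of the coefficients\<close>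

lemma coeff_0_class_poly: "coeff (class_poly s) 0 = 1"
  unfolding class_poly_def poly_0_coeff_0[symmetric] poly_prod by simp

text \<open>Strong induction along Newton's identities: sums, products and rational multiples of
  conjugate pairs are conjugate pairs.\<close>

lemma conjugate_pair_coeffs:
  "conjugate_pair (coeff (class_poly 1) k) (coeff (class_poly (-1)) k)"
proof (induction k rule: less_induct)
  case (less k)
  show ?case
  proof (cases k)
    case 0
    then show ?thesis by (simp add: coeff_0_class_poly conjugate_pair_rational)
  next
    case (Suc m)
    define S where "S s = (\<Sum>i\<le>m. coeff (class_poly s) i * (\<Sum>a\<in>chi_class s. \<zeta> a ^ Suc (m - i)))" for s
    have "coeff (class_poly s) k = (- 1 / of_nat (Suc m)) * S s" for s
      using newton_coeff[of "chi_class s" m \<zeta>]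
      by (simp add: Suc S_def class_poly_def divide_simps del: of_nat_Suc)
        (simp add: mult_ac)
    moreover have "conjugate_pair (S 1) (S (-1))"
      unfolding S_def using less Suc
      by (intro conjugate_pair_sum conjugate_pair_mult conjugate_pair_power_sums) auto
    moreover have "conjugate_pair (- 1 / of_nat (Suc m)) (- 1 / of_nat (Suc m))"
      by (rule conjugate_pair_rational) (auto simp del: of_nat_Suc)
    ultimately show ?thesis by (metis conjugate_pair_mult)
  qed
qed

lemma coeff_class_poly_in_cyclotomic_integers: "coeff (class_poly s) k \<in> cyclotomic_integers n"
  unfolding class_poly_def
  by (rule coeff_prod_in_cyclotomic_integers) (rule cyclotomic_integers.root)

text \<open>The irrational parts cancel, leaving a rational number in \<int>[\<zeta>].\<close>

lemma coeff_sum_int: "coeff (class_poly 1 + class_poly (-1)) k \<in> \<int>"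
proof (rule rational_cyclotomic_integer_is_int[OF n_pos])
  show "coeff (class_poly 1 + class_poly (-1)) k \<in> cyclotomic_integers n"
    by (simp add: cyclotomic_integers_add coeff_class_poly_in_cyclotomic_integers)
  obtain u v where "u \<in> \<rat>" "coeff (class_poly 1) k = u + v * G" "coeff (class_poly (-1)) k = u - v * G"
    using conjugate_pair_coeffs[of k] unfolding conjugate_pair_def by blast
  then show "coeff (class_poly 1 + class_poly (-1)) k \<in> \<rat>" by simp
qed

text \<open>The quotient by \<open>G\<close> is rational but not visibly in \<int>[\<zeta>]. Its
  square times \<open>n\<close> is the square of a difference of coefficients, hence an integer;
  squarefreeness of \<open>n\<close> then makes the quotient itself integral.\<close>

lemma coeff_diff_int:
  assumes "squarefree n"
  shows "coeff (smult (1 / G) (class_poly 1 - class_poly (-1))) k \<in> \<int>" (is "?c \<in> \<int>")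
proof -
  obtain u v where uv: "v \<in> \<rat>" "coeff (class_poly 1) k = u + v * G" "coeff (class_poly (-1)) k = u - v * G"
    using conjugate_pair_coeffs[of k] unfolding conjugate_pair_def by blast
  then have c: "?c = 2 * v" using G_neq_0 by simp
  then have "?c \<in> \<rat>" using uv(1) by simp
  then obtain r where r: "?c = of_rat r" by (elim Rats_cases)
  have "of_nat n * ?c\<^sup>2 = (coeff (class_poly 1) k - coeff (class_poly (-1)) k)\<^sup>2"
    unfolding c uv(2,3) by (simp add: G_square[symmetric] power_mult_distrib)
  also have "\<dots> \<in> cyclotomic_integers n"
    by (intro cyclotomic_integers_power cyclotomic_integers.diff coeff_class_poly_in_cyclotomic_integers)
  finally have cyc: "of_nat n * ?c\<^sup>2 \<in> cyclotomic_integers n" .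
  have eq: "of_nat n * ?c\<^sup>2 = of_rat (of_nat n * r\<^sup>2)"
    unfolding r by (simp add: of_rat_mult of_rat_power)
  have "(of_rat (of_nat n * r\<^sup>2) :: complex) \<in> \<int>"
    by (rule rational_cyclotomic_integer_is_int[OF n_pos cyc[unfolded eq] Rats_of_rat])
  then obtain m where "(of_rat (of_nat n * r\<^sup>2) :: complex) = of_rat (of_int m)" by (auto elim: Ints_cases)
  then have "of_nat n * r\<^sup>2 \<in> \<int>" by (simp only: of_rat_eq_iff Ints_of_int)
  then have "r \<in> \<int>" by (rule rational_root_of_squarefree_int[OF assms])
  then show ?thesis unfolding r by (auto elim!: Ints_cases)
qed

text \<open>Each linear coefficient is minus the first power sum; the rational parts cancel in the
  difference.\<close>

lemma coeff_1_diff: "coeff (class_poly 1 - class_poly (-1)) 1 = - G"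
proof -
  have "coeff (class_poly s) 1 = - (\<Sum>a\<in>chi_class s. \<zeta> (a * 1))" for s
    using newton_coeff[of "chi_class s" 0 \<zeta>] coeff_0_class_poly[of s] by (simp add: class_poly_def)
  then show ?thesis by (simp only: coeff_diff class_power_sum insertI1 insertI2) (simp add: field_simps)
qed

text \<open>Since \<chi> is even, \<open>a\<close> and \<open>n - a\<close> lie in the same class.
  The condition on \<open>s\<close> excludes the residue 0, whose partner \<open>n\<close> is not a
  residue.\<close>

lemma prod_chi_class:
  fixes h :: "int \<Rightarrow> 'a::comm_monoid_mult"
  assumes "s \<noteq> 0"
  shows "(\<Prod>a\<in>chi_class s. h a) = (\<Prod>a\<in>half_class s. h a * h (int n - a))"
proof -
  let ?r = "\<lambda>a. int n - a"
  have chi_r: "\<chi> (?r a) = \<chi> a" for a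
    using chi_cong[of "?r a" "- a"] by (simp add: cong_iff_dvd_diff)
  have "0 \<notin> chi_class s" using assms chi_eq_0_iff[of 0] n_gt_1 by (auto simp: chi_class_def)
  then have pos: "a > 0" if "a \<in> chi_class s" for a
    using that by (cases "a = 0") (auto simp: chi_class_def)
  have r_mem: "?r a \<in> chi_class s" if "a \<in> chi_class s" for a
    using that pos[OF that] chi_r[of a] by (auto simp: chi_class_def)
  have "chi_class s = half_class s \<union> ?r ` half_class s"
  proof (intro equalityI subsetI)
    fix a assume a: "a \<in> chi_class s"
    show "a \<in> half_class s \<union> ?r ` half_class s"
    proof (cases "2 * a < int n")
      case False
      have "2 * a \<noteq> int n" using odd_n by (metis dvd_triv_left even_of_nat)
      then have "?r a \<in> half_class s" using False r_mem[OF a] by (simp add: half_class_def)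
      then show ?thesis by (metis UnI2 diff_diff_eq2 add_diff_cancel_left' image_eqI)
    qed (use a in \<open>simp add: half_class_def\<close>)
  qed (use r_mem in \<open>auto simp: half_class_def\<close>)
  moreover have "half_class s \<inter> ?r ` half_class s = {}" by (auto simp: half_class_def)
  ultimately have "(\<Prod>a\<in>chi_class s. h a) = (\<Prod>a\<in>half_class s. h a) * (\<Prod>a\<in>?r ` half_class s. h a)"
    by (simp add: prod.union_disjoint)
  also have "(\<Prod>a\<in>?r ` half_class s. h a) = (\<Prod>a\<in>half_class s. h (?r a))"
    by (subst prod.reindex) (auto simp: inj_on_def)
  finally show ?thesis by (simp add: prod.distrib)
qed

text \<open>Both (1 - z X)(1 - X/z) and (X - z)(X - 1/z) equal 1 - (z + 1/z) X + X^2.\<close>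

lemma class_poly_half:
  assumes "s \<noteq> 0"
  shows "class_poly s = (\<Prod>a\<in>half_class s. [:1, - (\<zeta> a + \<zeta> (- a)), 1:])"
    and "(\<Prod>a\<in>chi_class s. [:- \<zeta> a, 1:]) = (\<Prod>a\<in>half_class s. [:1, - (\<zeta> a + \<zeta> (- a)), 1:])"
proof -
  have "\<zeta> (int n - a) = \<zeta> (- a)" for a by (rule zeta_cong) (simp add: cong_iff_dvd_diff)
  moreover have "\<zeta> a * \<zeta> (- a) = 1" for a using unity_root_uminus_mult[of n a] by (simp add: mult.commute)
  ultimately show "class_poly s = (\<Prod>a\<in>half_class s. [:1, - (\<zeta> a + \<zeta> (- a)), 1:])"
    and "(\<Prod>a\<in>chi_class s. [:- \<zeta> a, 1:]) = (\<Prod>a\<in>half_class s. [:1, - (\<zeta> a + \<zeta> (- a)), 1:])"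
    unfolding class_poly_def prod_chi_class[OF assms] by (auto intro!: prod.cong)
qed

lemma degree_class_poly:
  assumes "s \<noteq> 0"
  shows "degree (class_poly s) = card (chi_class s)" and "card (chi_class s) = 2 * card (half_class s)"
proof -
  have [simp]: "\<zeta> a \<noteq> 0" for a by (simp add: unity_root_def)
  have "degree (class_poly s) = (\<Sum>a\<in>chi_class s. degree [:1, - \<zeta> a:])"
    unfolding class_poly_def by (rule degree_prod_eq_sum_degree) auto
  then show *: "degree (class_poly s) = card (chi_class s)" by simp
  have "degree (class_poly s) = (\<Sum>a\<in>half_class s. degree [:1, - (\<zeta> a + \<zeta> (- a)), 1:])"
    unfolding class_poly_half(1)[OF assms] by (rule degree_prod_eq_sum_degree) auto
  then show "card (chi_class s) = 2 * card (half_class s)" using * by simp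
qed

text \<open>Each quadratic factor is its own reversal, and reversal is multiplicative.\<close>

lemma palindromic_class_poly:
  assumes "s \<noteq> 0"
  shows "palindromic (card (chi_class s)) (class_poly s)"
proof -
  have "reflect_poly [:1, c, 1:] = [:1, c, 1 :: complex:]" for c
    by (simp add: reflect_poly_def)
  then have "reflect_poly (class_poly s) = class_poly s"
    by (simp add: class_poly_half[OF assms] reflect_poly_prod)
  from palindromicI_reflect_poly[OF this] show ?thesis
    by (simp add: degree_class_poly[OF assms])
qed

section \<open>Factorisation of the cyclotomic polynomial\<close>

lemma card_chi_class_eq: "card (chi_class 1) = card (chi_class (-1))"
proof -
  have "(\<Sum>a\<in>residues. \<chi> a) = (\<Sum>a\<in>residues. (if \<chi> a = 1 then 1 else 0) - (if \<chi> a = -1 then 1 else 0))"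
    by (intro sum.cong refl) (use chi_values in auto)
  also have "\<dots> = int (card (chi_class 1)) - int (card (chi_class (-1)))"
    by (simp add: sum_subtractf chi_class_def flip: sum.inter_filter)
  finally show ?thesis using sum_chi by simp
qed

lemma coprime_residues_eq: "{a\<in>residues. coprime a (int n)} = chi_class 1 \<union> chi_class (-1)"
proof -
  have "coprime a (int n) \<longleftrightarrow> \<chi> a = 1 \<or> \<chi> a = -1" for a
    using chi_values[of a] chi_eq_0_iff[of a] by auto
  then show ?thesis by (auto simp: chi_class_def)
qed

lemma chi_class_disjoint: "chi_class 1 \<inter> chi_class (-1) = {}"
  by (auto simp: chi_class_def)

lemma totient_eq: "totient n = 2 * card (chi_class 1)"
  unfolding totient_eq_card_residues[OF n_gt_1] coprime_residues_eq
  by (simp add: card_Un_disjoint chi_class_disjoint card_chi_class_eq)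

lemma cyclotomic_eq: "cyclotomic n = class_poly 1 * class_poly (-1)"
proof -
  have "inj_on \<zeta> residues"
    by (rule inj_onI) (auto simp: unity_root_eq_iff[OF n_pos] cong_def)
  then have "inj_on \<zeta> (chi_class 1 \<union> chi_class (-1))"
    by (rule inj_on_subset) (auto simp: chi_class_def)
  then have "cyclotomic n = (\<Prod>a\<in>chi_class 1 \<union> chi_class (-1). [:- \<zeta> a, 1:])"
    unfolding cyclotomic_def primitive_roots_of_unity_eq[OF n_pos] coprime_residues_eq
    by (simp add: prod.reindex)
  also have "\<dots> = (\<Prod>a\<in>chi_class 1. [:- \<zeta> a, 1:]) * (\<Prod>a\<in>chi_class (-1). [:- \<zeta> a, 1:])"
    by (rule prod.union_disjoint) (simp_all add: chi_class_disjoint)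
  finally show ?thesis by (simp add: class_poly_half)
qed

text \<open>\<open>A\<close> is the sum of the class polynomials and X \<open>B\<close> is their
  difference divided by \<open>G\<close>. The constant terms are recorded because they become the
  leading coefficients in s.\<close>

lemma gauss_cyclotomic_formula:
  assumes "squarefree n"
  obtains A B :: "int poly" and m :: nat where
    "m > 0" "totient n = 4 * m"
    "4 * cyclotomic n = (map_poly of_int A)\<^sup>2 - of_nat n * [:0, 1:]\<^sup>2 * (map_poly of_int B)\<^sup>2"
    "palindromic (2 * m) A" "coeff A 0 = 2"
    "palindromic (2 * (m - 1)) B" "coeff B 0 = -1"
proof -
  define m where "m = card (half_class 1)"
  have deg: "card (chi_class s) = 2 * m" if "s \<in> {1, -1}" for s
    using that degree_class_poly(2)[of 1] card_chi_class_eq by (auto simp: m_def)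
  have tot: "totient n = 4 * m" using totient_eq deg[of 1] by simp
  then have m: "m > 0" using totient_gt_0_iff[of n] n_pos by simp
  note pal = palindromic_class_poly[of 1] palindromic_class_poly[of "-1"]
  obtain A :: "int poly" where A: "map_poly of_int A = class_poly 1 + class_poly (-1)"
    using coeff_sum_int by (rule integral_complex_poly)
  obtain C :: "int poly" where C: "map_poly of_int C = smult (1 / G) (class_poly 1 - class_poly (-1))"
    using coeff_diff_int[OF assms] by (rule integral_complex_poly)
  have coeff_A: "of_int (coeff A i) = coeff (class_poly 1) i + coeff (class_poly (-1)) i" for i
    using arg_cong[OF A, of "\<lambda>p. coeff p i"] by (simp add: coeff_map_poly)
  have coeff_C: "of_int (coeff C i) = coeff (class_poly 1 - class_poly (-1)) i / G" for i
    using arg_cong[OF C, of "\<lambda>p. coeff p i"] by (simp add: coeff_map_poly)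
  have pal_A: "palindromic (2 * m) A"
    by (rule palindromic_of_int[where 'a = complex], unfold A) (use pal deg in \<open>simp add: palindromic_def\<close>)
  have pal_C: "palindromic (2 * m) C"
    by (rule palindromic_of_int[where 'a = complex], unfold C) (use pal deg in \<open>simp add: palindromic_def\<close>)
  have "of_int (coeff A 0) = (of_int 2 :: complex)" by (simp add: coeff_A coeff_0_class_poly)
  then have A_0: "coeff A 0 = 2" by (simp only: of_int_eq_iff)
  have "of_int (coeff C 0) = (of_int 0 :: complex)" by (simp add: coeff_C coeff_0_class_poly)
  then have C_0: "coeff C 0 = 0" by (simp only: of_int_eq_iff)
  have "of_int (coeff C 1) = (of_int (-1) :: complex)"
    unfolding coeff_C coeff_1_diff using G_neq_0 by simp
  then have C_1: "coeff C 1 = -1" by (simp only: of_int_eq_iff)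
  obtain B where B: "C = pCons 0 B" using C_0 by (metis coeff_pCons_0 pCons_cases)
  have coeff_B: "coeff B i = coeff C (Suc i)" for i by (simp add: B)
  have pal_B: "palindromic (2 * (m - 1)) B"
    unfolding palindromic_def coeff_B
  proof (intro conjI allI impI)
    fix i assume "2 * (m - 1) < i"
    then have "Suc i = 2 * m \<or> Suc i > 2 * m" using m by linarith
    \<comment> \<open>By symmetry the top coefficient of \<open>C\<close> vanishes with the constant
      one, so dividing by X lowers the formal degree by 2.\<close>
    moreover have "coeff C (2 * m) = 0" using pal_C C_0 by (metis palindromic_def diff_zero le0)
    ultimately show "coeff C (Suc i) = 0" using pal_C unfolding palindromic_def by metis
  next
    fix i assume i: "i \<le> 2 * (m - 1)"
    then have "Suc (2 * (m - 1) - i) = 2 * m - Suc i" "Suc i \<le> 2 * m" using m by linarith+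
    then show "coeff C (Suc (2 * (m - 1) - i)) = coeff C (Suc i)"
      using pal_C unfolding palindromic_def by metis
  qed
  have C_B: "map_poly of_int C = [:0, 1:] * (map_poly of_int B :: complex poly)" by (simp add: B map_poly_pCons)
  have "class_poly 1 - class_poly (-1) = smult G (smult (1 / G) (class_poly 1 - class_poly (-1)))"
    using G_neq_0 by simp
  also have "\<dots> = smult G ([:0, 1:] * map_poly of_int B)"
    by (simp only: C_B flip: C)
  finally have "(class_poly 1 - class_poly (-1))\<^sup>2 = of_nat n * [:0, 1:]\<^sup>2 * (map_poly of_int B)\<^sup>2"
    by (simp only: smult_power power_mult_distrib G_square) (simp add: of_nat_poly)
  moreover have "4 * cyclotomic n =
    (class_poly 1 + class_poly (-1))\<^sup>2 - (class_poly 1 - class_poly (-1))\<^sup>2"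
    unfolding cyclotomic_eq by (simp add: power2_eq_square algebra_simps)
  ultimately have "4 * cyclotomic n =
    (map_poly of_int A)\<^sup>2 - of_nat n * [:0, 1:]\<^sup>2 * (map_poly of_int B)\<^sup>2"
    by (simp only: A)
  with m tot pal_A A_0 pal_B show thesis using C_1 coeff_B[of 0] by (intro that) auto
qed

end

section \<open>Palindromic polynomials as binary forms\<close>

text \<open>One interface for the constant embeddings into polynomials in one or two variables and
  for the maps from integer to complex coefficients.\<close>

locale comm_ring_morphism =
  fixes h :: "'a::comm_ring_1 \<Rightarrow> 'b::comm_ring_1"
  assumes hom_1: "h 1 = 1"
    and hom_add: "h (x + y) = h x + h y"
    and hom_mult: "h (x * y) = h x * h y"
begin

lemma hom_0: "h 0 = 0"
  using hom_add[of 0 0] by simp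

lemma hom_uminus: "h (- x) = - h x"
  using hom_add[of "- x" x] by (simp add: hom_0 eq_neg_iff_add_eq_0)

lemma hom_diff: "h (x - y) = h x - h y"
  using hom_add[of x "- y"] by (simp add: hom_uminus)

lemma hom_sum: "h (sum f A) = (\<Sum>x\<in>A. h (f x))"
  by (induction A rule: infinite_finite_induct) (simp_all add: hom_0 hom_add)

lemma hom_power: "h (x ^ k) = h x ^ k"
  by (induction k) (simp_all add: hom_1 hom_mult)

lemma map_poly_morphism: "comm_ring_morphism (map_poly h)"
proof
  show "map_poly h 1 = 1" by (simp add: hom_1 map_poly_1)
  show "map_poly h (p + q) = map_poly h p + map_poly h q" for p q
    by (rule poly_eqI) (simp add: coeff_map_poly hom_0 hom_add)
  show "map_poly h (p * q) = map_poly h p * map_poly h q" for p q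
    by (rule poly_eqI) (simp add: coeff_map_poly hom_0 coeff_mult hom_sum hom_mult)
qed

end

lemma of_int_morphism: "comm_ring_morphism of_int"
  by unfold_locales simp_all

lemma const_poly_morphism: "comm_ring_morphism (\<lambda>c. [:c:])"
  by unfold_locales (simp_all add: one_pCons)

lemma bconst_morphism: "comm_ring_morphism bconst"
  by unfold_locales (simp_all add: one_pCons)

lemma of_int_bipoly_morphism: "comm_ring_morphism of_int_bipoly"
  unfolding of_int_bipoly_def
  by (intro comm_ring_morphism.map_poly_morphism of_int_morphism)

text \<open>The homogenisation X^m p(Y/X) for \<open>p\<close> of degree at most \<open>m\<close>,
  with coefficients transported by \<open>c\<close>. The same \<open>p\<close> can thus be evaluated
  in different rings.\<close>

definition binary_form ::
  "('a::zero \<Rightarrow> 'b::comm_semiring_1) \<Rightarrow> nat \<Rightarrow> 'a poly \<Rightarrow> 'b \<Rightarrow> 'b \<Rightarrow> 'b" where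
  "binary_form c m p X Y = (\<Sum>j\<le>m. c (coeff p j) * X ^ (m - j) * Y ^ j)"

lemma binary_form_map_poly:
  "f 0 = 0 \<Longrightarrow> binary_form c m (map_poly f p) X Y = binary_form (\<lambda>x. c (f x)) m p X Y"
  by (simp add: binary_form_def coeff_map_poly)

lemma binary_form_pCons:
  "binary_form c (Suc m) (pCons a p) X Y = c a * X ^ Suc m + Y * binary_form c m p X Y"
  unfolding binary_form_def by (subst sum.atMost_Suc_shift) (simp add: sum_distrib_left mult_ac)

context comm_ring_morphism
begin

lemma hom_binary_form: "h (binary_form c m p X Y) = binary_form (\<lambda>x. h (c x)) m p (h X) (h Y)"
  by (simp add: binary_form_def hom_sum hom_mult hom_power)

lemma binary_form_diff: "binary_form h m (p - q) X Y = binary_form h m p X Y - binary_form h m q X Y"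
  by (simp add: binary_form_def hom_diff algebra_simps sum_subtractf)

lemma binary_form_smult: "binary_form h m (smult k p) X Y = h k * binary_form h m p X Y"
  by (simp add: binary_form_def hom_mult sum_distrib_left mult_ac)

lemma binary_form_mult:
  assumes "degree p \<le> m" and "degree q \<le> k"
  shows "binary_form h m p X Y * binary_form h k q X Y = binary_form h (m + k) (p * q) X Y"
proof -
  \<comment> \<open>\<open>Y\<close> is replaced by an indeterminate, which reduces the claim to a
    comparison of coefficients.\<close>
  define P where "P d r = (\<Sum>j\<le>d. monom (h (coeff r j) * X ^ (d - j)) j)" for d r
  have poly_P: "poly (P d r) Y = binary_form h d r X Y" for d r
    by (simp add: P_def binary_form_def poly_sum poly_monom)
  have coeff_P: "coeff (P d r) j = h (coeff r j) * X ^ (d - j)" if "degree r \<le> d" for d r j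
  proof (cases "j \<le> d")
    case False
    then show ?thesis using that by (simp add: P_def coeff_sum coeff_eq_0 hom_0)
  qed (simp add: P_def coeff_sum)
  have "P m p * P k q = P (m + k) (p * q)"
  proof (rule poly_eqI)
    fix j
    have "coeff (P m p * P k q) j = (\<Sum>i\<le>j. h (coeff p i * coeff q (j - i)) * X ^ (m + k - j))"
      unfolding coeff_mult coeff_P[OF assms(1)] coeff_P[OF assms(2)]
    proof (intro sum.cong refl)
      fix i assume i: "i \<in> {..j}"
      show "h (coeff p i) * X ^ (m - i) * (h (coeff q (j - i)) * X ^ (k - (j - i))) =
        h (coeff p i * coeff q (j - i)) * X ^ (m + k - j)"
      \<comment> \<open>Outside this range subtraction in the exponents truncates, but the degree
        bounds force one of the coefficients to be 0.\<close>
      proof (cases "i \<le> m \<and> j - i \<le> k")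
        case True
        then have "(m - i) + (k - (j - i)) = m + k - j" using i unfolding atMost_iff by arith
        then have "X ^ (m + k - j) = X ^ (m - i) * X ^ (k - (j - i))" by (metis power_add)
        then show ?thesis by (simp only: hom_mult mult_ac)
      next
        case False
        then have "coeff p i = 0 \<or> coeff q (j - i) = 0"
          using assms by (metis coeff_eq_0 le_less_trans not_le_imp_less)
        then show ?thesis by (auto simp: hom_0)
      qed
    qed
    also have "\<dots> = coeff (P (m + k) (p * q)) j"
      using assms degree_mult_le[of p q]
      by (subst coeff_P) (auto simp: coeff_mult hom_sum sum_distrib_right)
    finally show "coeff (P m p * P k q) j = coeff (P (m + k) (p * q)) j" .
  qed
  then show ?thesis by (metis poly_P poly_mult)
qed

text \<open>The shape of Gauss's identity for arbitrary \<open>X\<close> and \<open>Y\<close>. It is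
  used twice: at (1 + q)^2 and q for the cyclotomic polynomial, and at s^2 and -t for the Lucas
  atom.\<close>

lemma binary_form_norm:
  assumes "m > 0" and "degree a \<le> m" and "degree b \<le> m - 1"
  shows "binary_form h (2 * m) (a\<^sup>2 - smult k ([:0, 1:]\<^sup>2 * b\<^sup>2)) X Y =
    (binary_form h m a X Y)\<^sup>2 - h k * Y\<^sup>2 * (binary_form h (m - 1) b X Y)\<^sup>2"
proof -
  have sq: "[:0, 1:]\<^sup>2 * b\<^sup>2 = pCons 0 b * pCons 0 b" by (simp add: power2_eq_square)
  have "degree (pCons 0 b) \<le> m" using assms by (cases "b = 0") auto
  then have "binary_form h (2 * m) ([:0, 1:]\<^sup>2 * b\<^sup>2) X Y = (binary_form h m (pCons 0 b) X Y)\<^sup>2"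
    unfolding sq mult_2 by (simp only: binary_form_mult power2_eq_square)
  moreover have "binary_form h m (pCons 0 b) X Y = Y * binary_form h (m - 1) b X Y"
    using assms(1) binary_form_pCons[of h "m - 1" 0 b X Y] by (simp add: hom_0)
  moreover have "binary_form h (2 * m) (a\<^sup>2) X Y = (binary_form h m a X Y)\<^sup>2"
    using assms(2) unfolding mult_2 power2_eq_square by (simp only: binary_form_mult)
  ultimately show ?thesis
    by (simp only: binary_form_diff binary_form_smult power_mult_distrib mult.assoc)
qed

end

text \<open>Subtracting the constant term times (1 + q)^(2m) leaves a palindromic polynomial whose
  two end coefficients vanish; dividing it by q lowers \<open>m\<close> by 1. No division of
  coefficients occurs, so integrality is preserved.\<close>

lemma palindromic_binary_form:
  fixes A :: "'a::comm_ring_1 poly"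
  assumes "palindromic (2 * m) A"
  shows "\<exists>p. degree p \<le> m \<and> coeff p 0 = coeff A 0 \<and>
    A = binary_form (\<lambda>c. [:c:]) m p ([:1, 1:]\<^sup>2) [:0, 1:]"
  using assms
proof (induction m arbitrary: A)
  case 0
  define a where "a = coeff A 0"
  have "A = [:a:]" using 0 unfolding a_def
    by (intro poly_eqI) (auto simp: palindromic_def coeff_pCons split: nat.split)
  then show ?case by (intro exI[of _ "[:a:]"]) (simp add: binary_form_def)
next
  case (Suc m)
  define a where "a = coeff A 0"
  define D where "D = A - smult a ([:1, 1:] ^ (2 * Suc m))"
  have coeff_D: "coeff D i = coeff A i - a * of_nat ((2 * Suc m) choose i)" for i
  proof (cases "i \<le> 2 * Suc m")
    case True
    then show ?thesis
      unfolding D_def coeff_diff coeff_smult by (subst coeff_linear_poly_power) auto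
  next
    case False
    moreover have "degree ([:1, 1:] ^ (2 * Suc m) :: 'a poly) \<le> 2 * Suc m"
      using degree_power_le[of "[:1, 1:] :: 'a poly" "2 * Suc m"] by simp
    ultimately have "coeff ([:1, 1:] ^ (2 * Suc m) :: 'a poly) i = 0" by (intro coeff_eq_0) simp
    then show ?thesis
      using False unfolding D_def coeff_diff coeff_smult by (simp only: binomial_eq_0) simp
  qed
  have D_0: "coeff D 0 = 0" by (simp add: coeff_D a_def)
  have pal_D: "palindromic (2 * Suc m) D"
    using Suc.prems unfolding palindromic_def coeff_D by (auto simp: binomial_eq_0 simp flip: binomial_symmetric)
  obtain C where C: "D = pCons 0 C" using D_0 by (metis coeff_pCons_0 pCons_cases)
  have coeff_C: "coeff C i = coeff D (Suc i)" for i by (simp add: C)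
  have "palindromic (2 * m) C"
    unfolding palindromic_def coeff_C
  proof (intro conjI allI impI)
    fix i assume "2 * m < i"
    then have "Suc i = 2 * Suc m \<or> Suc i > 2 * Suc m" by arith
    moreover have "coeff D (2 * Suc m) = 0" using pal_D D_0 by (metis palindromic_def diff_zero le0)
    ultimately show "coeff D (Suc i) = 0" using pal_D unfolding palindromic_def by metis
  next
    fix i assume i: "i \<le> 2 * m"
    then have "Suc (2 * m - i) = 2 * Suc m - Suc i" "Suc i \<le> 2 * Suc m" by arith+
    then show "coeff D (Suc (2 * m - i)) = coeff D (Suc i)"
      using pal_D unfolding palindromic_def by metis
  qed
  from Suc.IH[OF this] obtain p where p: "degree p \<le> m"
    "C = binary_form (\<lambda>c. [:c:]) m p ([:1, 1:]\<^sup>2) [:0, 1:]" by blast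
  have "A = smult a ([:1, 1:] ^ (2 * Suc m)) + [:0, 1:] * C" using C by (simp add: D_def algebra_simps)
  also have "[:1, 1:] ^ (2 * Suc m) = (([:1, 1:] :: 'a poly)\<^sup>2) ^ Suc m" by (rule power_mult)
  finally have "A = binary_form (\<lambda>c. [:c:]) (Suc m) (pCons a p) ([:1, 1:]\<^sup>2) [:0, 1:]"
    unfolding binary_form_pCons p(2)[symmetric] by simp
  moreover have "degree (pCons a p) \<le> Suc m" using p(1) by (meson Suc_le_mono degree_pCons_le le_trans)
  ultimately show ?case by (intro exI[of _ "pCons a p"]) (simp add: a_def)
qed

text \<open>The system is triangular: the basis element with index j starts with q^j with
  coefficient 1, whatever the exponent \<open>e j\<close>.\<close>

lemma palindromic_expansion_unique:
  fixes g h :: "nat \<Rightarrow> 'a::comm_ring_1"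
  assumes "(\<Sum>j\<le>m. smult (g j) ([:0, 1:] ^ j * [:1, 1:] ^ (e j))) =
      (\<Sum>j\<le>m. smult (h j) ([:0, 1:] ^ j * [:1, 1:] ^ (e j)))"
    and "i \<le> m"
  shows "g i = h i"
  using assms(2)
proof (induction i rule: less_induct)
  case (less i)
  define d where "d j = g j - h j" for j
  have "0 = (\<Sum>j\<le>m. smult (d j) ([:0, 1:] ^ j * [:1, 1:] ^ (e j)))"
    using assms(1) by (simp add: d_def smult_diff_left sum_subtractf)
  then have "0 = coeff (\<Sum>j\<le>m. smult (d j) ([:0, 1:] ^ j * [:1, 1:] ^ (e j))) i"
    by (metis coeff_0)
  also have "\<dots> = (\<Sum>j\<le>m. if j = i then d j else 0)"
    unfolding coeff_sum
  proof (rule sum.cong)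
    fix j assume "j \<in> {..m}"
    have "[:0, 1:] ^ j = monom (1 :: 'a) j" by (simp add: monom_altdef)
    then have "coeff ([:0, 1:] ^ j * [:1, 1:] ^ e j :: 'a poly) i =
      (if i < j then 0 else coeff ([:1, 1:] ^ e j) (i - j))"
      by (simp add: coeff_monom_mult)
    moreover have "coeff ([:1, 1:] ^ e j :: 'a poly) 0 = 1"
      by (simp add: coeff_0_power)
    moreover have "d j = 0" if "j < i" using less that by (simp add: d_def)
    ultimately show "coeff (smult (d j) ([:0, 1:] ^ j * [:1, 1:] ^ e j)) i = (if j = i then d j else 0)"
      by (cases j i rule: linorder_cases) auto
  qed simp
  also have "\<dots> = d i" using less.prems by simp
  finally show ?case by (simp add: d_def)
qed

section \<open>Lucas atoms as binary forms\<close>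

lemma lucas_gamma_eqI:
  assumes "\<And>j. j > totient n div 2 \<Longrightarrow> g j = 0"
    and "cyclotomic n =
      (\<Sum>j\<le>totient n div 2. smult (g j) ([:0, 1:] ^ j * [:1, 1:] ^ (totient n - 2 * j)))"
  shows "lucas_gamma n = g"
  unfolding lucas_gamma_def
proof (rule the_equality)
  fix g' assume g': "(\<forall>j. j > totient n div 2 \<longrightarrow> g' j = 0) \<and>
     cyclotomic n =
       (\<Sum>j\<le>totient n div 2. smult (g' j) ([:0, 1:] ^ j * [:1, 1:] ^ (totient n - 2 * j)))"
  show "g' = g"
  proof
    fix j
    show "g' j = g j"
    proof (cases "j \<le> totient n div 2")
      case True
      with g' assms(2) show ?thesis
        by (intro palindromic_expansion_unique[where e = "\<lambda>j. totient n - 2 * j"]) auto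
    qed (use g' assms(1) in auto)
  qed
qed (use assms in auto)

text \<open>The coefficients of \<open>r\<close> are the gamma_j, since its degree bound supplies
  the zeros beyond \<open>d\<close>. As the totient is even, only even powers of 1 + q and of s
  occur.\<close>

lemma lucas_atom_eq_binary_form:
  assumes "totient n = 2 * d" and "degree r \<le> d"
    and "cyclotomic n = binary_form (\<lambda>c. [:c:]) d r ([:1, 1:]\<^sup>2) [:0, 1:]"
  shows "lucas_atom n = binary_form bconst d r (svar\<^sup>2) (- tvar)"
proof -
  have exp: "x ^ (totient n - 2 * j) = (x\<^sup>2) ^ (d - j)" for x :: "'a::comm_semiring_1" and j
    by (simp add: assms(1) flip: power_mult diff_mult_distrib2)
  have "lucas_gamma n = coeff r"
  proof (rule lucas_gamma_eqI)
    show "coeff r j = 0" if "j > totient n div 2" for j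
      using that assms(1,2) by (simp add: coeff_eq_0)
    show "cyclotomic n =
      (\<Sum>j\<le>totient n div 2. smult (coeff r j) ([:0, 1:] ^ j * [:1, 1:] ^ (totient n - 2 * j)))"
      unfolding assms(3) binary_form_def exp using assms(1)
      by (intro sum.cong) (auto simp: mult_ac)
  qed
  then show ?thesis
    unfolding lucas_atom_def binary_form_def exp using assms(1) by simp
qed

text \<open>Only the index 0 contributes to s^(2m), and its coefficient is the nonzero constant
  \<open>coeff p 0\<close>.\<close>

lemma degree_binary_form_bconst:
  fixes p :: "'a::comm_ring_1 poly" and m :: nat
  assumes "coeff p 0 \<noteq> 0"
  defines "F \<equiv> binary_form bconst m p (svar\<^sup>2) (- tvar)"
  shows "F \<noteq> 0" and "sdeg F = 2 * m"
proof -
  have coeff_F: "coeff F i = (\<Sum>j\<le>m. if 2 * (m - j) = i then [:coeff p j:] * (- [:0, 1:]) ^ j else 0)" for i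
    unfolding F_def binary_form_def coeff_sum
  proof (rule sum.cong)
    fix j
    have "(- tvar) ^ j = ([:(- [:0, 1:]) ^ j:] :: 'a bipoly)"
      by (simp add: tvar_def poly_const_pow)
    moreover have "(svar\<^sup>2) ^ (m - j) = (monom 1 (2 * (m - j)) :: 'a bipoly)"
      by (simp add: svar_def monom_altdef flip: power_mult)
    ultimately have "bconst (coeff p j) * (svar\<^sup>2) ^ (m - j) * (- tvar) ^ j =
      smult ([:coeff p j:] * (- [:0, 1:]) ^ j) (monom 1 (2 * (m - j)))"
      by (simp add: mult_ac)
    then show "coeff (bconst (coeff p j) * (svar\<^sup>2) ^ (m - j) * (- tvar) ^ j) i =
      (if 2 * (m - j) = i then [:coeff p j:] * (- [:0, 1:]) ^ j else 0)"
      by simp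
  qed simp
  have "coeff F (2 * m) = (\<Sum>j\<le>m. if j = 0 then [:coeff p j:] * (- [:0, 1:]) ^ j else 0)"
    unfolding coeff_F by (intro sum.cong) auto
  then have lead: "coeff F (2 * m) \<noteq> 0" using assms(1) by simp
  then show "F \<noteq> 0" by auto
  have "degree F \<le> 2 * m"
    by (rule degree_le) (auto simp: coeff_F intro!: sum.neutral)
  then show "sdeg F = 2 * m" using lead le_degree[of F "2 * m"] by simp
qed

text \<open>Because \<open>sdeg\<close> is 0 at the zero polynomial, the degree equation by itself
  would admit \<open>F = 0\<close> when the totient is 4; hence the separate conjunct.\<close>

theorem theorem4p4:
  fixes n :: nat
  assumes "n \<ge> 5" and "squarefree n" and "n mod 4 = 1"
  shows "\<exists>E F :: int bipoly.
           4 * lucas_atom n =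
             (of_int_bipoly E)\<^sup>2 - of_nat n * tvar\<^sup>2 * (of_int_bipoly F)\<^sup>2 \<and>
           sdeg E = totient n div 2 \<and>
           F \<noteq> 0 \<and> sdeg F = totient n div 2 - 2"
proof -
  have "odd n" using assms(3) by presburger
  interpret even_primitive_character n "jacobi n"
  proof
    show "n > 1" using assms(1) by simp
    then show "jacobi n a = 0 \<longleftrightarrow> \<not> coprime a (int n)" for a
      by (intro jacobi_eq_0_iff) simp
  qed (use \<open>odd n\<close> assms(2,3) in \<open>simp_all add: jacobi_values[simplified] jacobi_mult jacobi_cong
        jacobi_minus_one jacobi_primitive\<close>)
  obtain A B :: "int poly" and m where m: "m > 0" "totient n = 4 * m"
    and AB: "4 * cyclotomic n =
      (map_poly of_int A)\<^sup>2 - of_nat n * [:0, 1:]\<^sup>2 * (map_poly of_int B)\<^sup>2"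
    and A: "palindromic (2 * m) A" "coeff A 0 = 2"
    and B: "palindromic (2 * (m - 1)) B" "coeff B 0 = -1"
    using gauss_cyclotomic_formula[OF assms(2)] by blast
  obtain a where a: "degree a \<le> m" "coeff a 0 = 2"
    "A = binary_form (\<lambda>c. [:c:]) m a ([:1, 1:]\<^sup>2) [:0, 1:]"
    using palindromic_binary_form[OF A(1)] A(2) by auto
  obtain b where b: "degree b \<le> m - 1" "coeff b 0 = -1"
    "B = binary_form (\<lambda>c. [:c:]) (m - 1) b ([:1, 1:]\<^sup>2) [:0, 1:]"
    using palindromic_binary_form[OF B(1)] B(2) by auto
  define ac bc :: "complex poly" where "ac = map_poly of_int a" and "bc = map_poly of_int b"
  have deg: "degree ac \<le> m" "degree bc \<le> m - 1"
    using a(1) b(1) map_poly_degree_leq le_trans unfolding ac_def bc_def by blast+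

  \<comment> \<open>The form of degree \<open>2 * m\<close> whose value at (1 + q)^2 and q is four
    times the cyclotomic polynomial.\<close>
  define r where "r = ac\<^sup>2 - smult (of_nat n) ([:0, 1:]\<^sup>2 * bc\<^sup>2)"
  have deg_r: "degree r \<le> 2 * m"
  proof -
    have "degree (ac\<^sup>2) \<le> 2 * m" using degree_power_le[of ac 2] deg(1) by linarith
    moreover have "degree ([:0, 1:]\<^sup>2 * bc\<^sup>2) \<le> 2 * m"
      using degree_mult_le[of "[:0, 1:]\<^sup>2" "bc\<^sup>2"] degree_power_le[of "[:0, 1 :: complex:]" 2]
        degree_power_le[of bc 2] deg(2) m(1) by simp
    ultimately show ?thesis unfolding r_def by (intro degree_diff_le) (auto intro: le_trans[OF degree_smult_le])
  qed

  interpret P: comm_ring_morphism "map_poly of_int :: int poly \<Rightarrow> complex poly"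
    by (intro comm_ring_morphism.map_poly_morphism of_int_morphism)
  interpret C: comm_ring_morphism "\<lambda>c. [:c :: complex:]" by (rule const_poly_morphism)
  interpret D: comm_ring_morphism "\<lambda>c. bconst (c :: complex)" by (rule bconst_morphism)
  interpret I: comm_ring_morphism of_int_bipoly by (rule of_int_bipoly_morphism)

  have form_P: "map_poly of_int (binary_form (\<lambda>c. [:c:]) k p ([:1, 1:]\<^sup>2) [:0, 1:]) =
    binary_form (\<lambda>c. [:c :: complex:]) k (map_poly of_int p) ([:1, 1:]\<^sup>2) [:0, 1:]" for k p
    by (simp add: P.hom_binary_form P.hom_power binary_form_map_poly map_poly_pCons)
  have form_I: "of_int_bipoly (binary_form bconst k p (svar\<^sup>2) (- tvar)) =
    binary_form bconst k (map_poly of_int p) (svar\<^sup>2) (- tvar)" for k p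
  proof -
    have "of_int_bipoly svar = svar" "of_int_bipoly tvar = tvar" "of_int_bipoly (bconst c) = bconst (of_int c)" for c
      by (simp_all add: of_int_bipoly_def svar_def tvar_def map_poly_pCons)
    then show ?thesis by (simp add: I.hom_binary_form I.hom_power I.hom_uminus binary_form_map_poly)
  qed

  have "4 * cyclotomic n = binary_form (\<lambda>c. [:c:]) (2 * m) r ([:1, 1:]\<^sup>2) [:0, 1:]"
    unfolding AB a(3) b(3) form_P r_def ac_def[symmetric] bc_def[symmetric]
    by (simp add: C.binary_form_norm[OF m(1) deg] of_nat_poly)
  \<comment> \<open>The factor 4 is moved into the coefficients, as the lemma on Lucas atoms needs a
    form for the cyclotomic polynomial itself; it is restored after the substitution.\<close>
  moreover have "cyclotomic n = [:1 / 4:] * 4 * cyclotomic n"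
    by (simp add: numeral_poly flip: one_pCons)
  ultimately have "cyclotomic n =
    binary_form (\<lambda>c. [:c:]) (2 * m) (smult (1 / 4) r) ([:1, 1:]\<^sup>2) [:0, 1:]"
    by (simp only: C.binary_form_smult mult.assoc)
  then have "lucas_atom n = binary_form bconst (2 * m) (smult (1 / 4) r) (svar\<^sup>2) (- tvar)"
    using m(2) deg_r by (intro lucas_atom_eq_binary_form) simp_all
  then have "4 * lucas_atom n = 4 * bconst (1 / 4) * binary_form bconst (2 * m) r (svar\<^sup>2) (- tvar)"
    by (simp only: D.binary_form_smult mult.assoc)
  also have "4 * bconst (1 / 4 :: complex) = 1"
    by (simp add: numeral_poly one_pCons)
  \<comment> \<open>The norm identity again, now at s^2 and -t; the sign of t disappears in the
    square.\<close>
  also have "1 * binary_form bconst (2 * m) r (svar\<^sup>2) (- tvar) =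
    (binary_form bconst m ac (svar\<^sup>2) (- tvar))\<^sup>2 -
      of_nat n * tvar\<^sup>2 * (binary_form bconst (m - 1) bc (svar\<^sup>2) (- tvar))\<^sup>2"
    unfolding r_def by (simp add: D.binary_form_norm[OF m(1) deg] of_nat_poly)
  finally have "4 * lucas_atom n =
    (of_int_bipoly (binary_form bconst m a (svar\<^sup>2) (- tvar)))\<^sup>2 -
      of_nat n * tvar\<^sup>2 * (of_int_bipoly (binary_form bconst (m - 1) b (svar\<^sup>2) (- tvar)))\<^sup>2"
    unfolding form_I ac_def bc_def .
  moreover have "sdeg (binary_form bconst m a (svar\<^sup>2) (- tvar)) = totient n div 2"
    using degree_binary_form_bconst(2)[of a m] a(2) m(2) by simp
  moreover have "sdeg (binary_form bconst (m - 1) b (svar\<^sup>2) (- tvar)) = totient n div 2 - 2"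
    using degree_binary_form_bconst(2)[of b "m - 1"] b(2) m by simp
  moreover have "binary_form bconst (m - 1) b (svar\<^sup>2) (- tvar) \<noteq> 0"
    using degree_binary_form_bconst(1)[of b "m - 1"] b(2) by simp
  ultimately show ?thesis by blast
qed

end
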